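(* Let $n\ge 2$, let $X_1,\dots,X_n$ be real Hilbert spaces and $\mathbf{X}=X_1\times\cdots\times X_n$. Let $A_i\colon X_i\to X_i'$ ($i=1,\dots,n$) be bounded, self-adjoint, positive semi-definite linear operators and $B_i\colon X_i\to X_{i+1}'$ ($i=1,\dots,n-1$) bounded linear operators. Assume that the Schur complements $S_1=A_1$, $S_{i+1}=A_{i+1}+B_iS_i^{-1}B_i'$ ($i=1,\dots,n-1$) are well-defined and positive definite, i.e. there are constants $\sigma_i>0$ with $\langle S_ix_i,x_i\rangle\ge\sigma_i\|x_i\|_{X_i}^2$ for all $x_i\in X_i$, $i=1,\dots,n$. Assume additionally that $A_i=0$ for $i=2,\dots,n$. Let $\mathcal{A}\colon\mathbf{X}\to\mathbf{X}'$ be the block tridiagonal operator with diagonal blocks $(-1)^{i-1}A_i$, subdiagonal blocks $B_i$ (in position $(i+1,i)$) and superdiagonal blocks $B_i'$ (in position $(i,i+1)$), let $\mathcal{S}=\operatorname{diag}(S_1,\dots,S_n)$ and $\mathcal{M}=\mathcal{S}^{-1}\mathcal{A}\colon\mathbf{X}\to\mathbf{X}$. Then the set $\sigma_p(\mathcal{M})$ of all eigenvalues of $\mathcal{M}$ is given by $$\sigma_p(\mathcal{M})=\left\{2\cos\left(\frac{2i-1}{2j+1}\pi\right)\colon j=1,\dots,n,\ i=1,\dots,j\right\}.$$ Moreover, $$\|\mathcal{M}\|_{\mathcal{L}(\mathbf{X},\mathbf{X})}=\max\{|\lambda|\colon\lambda\in\sigma_p(\mathcal{M})\}=2\cos\left(\frac{\pi}{2n+1}\right)$$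 and $$\|\mathcal{M}^{-1}\|_{\mathcal{L}(\mathbf{X},\mathbf{X})}=\max\left\{\frac{1}{|\lambda|}\colon\lambda\in\sigma_p(\mathcal{M})\right\}=\frac{1}{2\sin\left(\frac{\pi}{2(2n+1)}\right)},$$ so that $\kappa(\mathcal{A})=\kappa(\mathcal{M})=\cos\left(\frac{\pi}{2n+1}\right)\big/\sin\left(\frac{\pi}{2(2n+1)}\right)$.
   Context: $X'$ is the dual of $X$ and $\langle\cdot,\cdot\rangle$ the duality product. For a bounded operator $B\colon X\to Y'$, the adjoint $B'\colon Y\to X'$ is given by $\langle B'y,x\rangle=\langle Bx,y\rangle$ for all $x\in X,\ y\in Y$. $A_i$ is self-adjoint and positive semi-definite if $\langle A_iy_i,x_i\rangle=\langle A_ix_i,y_i\rangle$ and $\langle A_ix_i,x_i\rangle\ge0$ for all $x_i,y_i\in X_i$. The space $\mathbf{X}$ is equipped with the norm $\|\cdot\|_{\mathcal{S}}$ induced by the inner product $(\mathbf{x},\mathbf{y})_{\mathcal{S}}=\langle\mathcal{S}\mathbf{x},\mathbf{y}\rangle=\sum_{i=1}^n\langle S_ix_i,y_i\rangle$, and $\mathbf{X}'$ with the associated dual norm. $\mathcal{L}(X,Y)$ denotes bounded linear operators with the operator norm. The condition numbers are $\kappa(\mathcal{A})=\|\mathcal{A}\|_{\mathcal{L}(\mathbf{X},\mathbf{X}')}\|\mathcal{A}^{-1}\|_{\mathcal{L}(\mathbf{X}',\mathbf{X})}$ and $\kappa(\mathcal{M})=\|\mathcal{M}\|_{\mathcal{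L}(\mathbf{X},\mathbf{X})}\|\mathcal{M}^{-1}\|_{\mathcal{L}(\mathbf{X},\mathbf{X})}$.
   Formalization: X_n is assumed nonzero, and equality of the eigenvalue set is claimed only when every ker B_i (i<n) is nontrivial (otherwise only inclusion): n=2, X_1=X_2=R, A_1=B_1=1 gives eigenvalues (1±√5)/2, without the listed value 1. *)

theory Defs
  imports "HOL-Analysis.Analysis" "HOL-Library.Function_Algebras"
begin

text \<open>
  Pointwise scalar multiplication. Together with \<^theory>\<open>HOL-Library.Function_Algebras\<close> this makes
  functionals (\<^typ>\<open>'a \<Rightarrow> real\<close>), operators into dual spaces and tuples (\<^typ>\<open>nat \<Rightarrow> 'a\<close>) elements
  of real vector spaces.
\<close>

instantiation "fun" :: (type, scaleR) scaleR
begin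

definition scaleR_fun :: "real \<Rightarrow> ('a \<Rightarrow> 'b) \<Rightarrow> 'a \<Rightarrow> 'b"
  where "scaleR_fun c f = (\<lambda>x. c *\<^sub>R f x)"

instance ..

end

instance "fun" :: (type, real_vector) real_vector
  by standard (simp_all add: scaleR_fun_def fun_eq_iff scaleR_add_right scaleR_add_left)

text \<open>
  A normed space is a linear subspace of some ambient real vector space, equipped with a norm of
  its own. An operator between such spaces is a total function that vanishes outside of the
  carrier of its domain; hence operators (and functionals) are equal as functions
  iff they agree on the carrier.
\<close>

record 'a nspace =
  pts :: "'a set"
  nrm :: "'a \<Rightarrow> real"

definition bounded_ops :: "'a::real_vector nspace \<Rightarrow> 'b::real_vector nspace \<Rightarrow> ('a \<Rightarrow> 'b) set"
  where "bounded_ops E F =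
    {T. (\<forall>x\<in>pts E. T x \<in> pts F) \<and>
        (\<forall>x\<in>pts E. \<forall>y\<in>pts E. T (x + y) = T x + T y) \<and>
        (\<forall>c. \<forall>x\<in>pts E. T (c *\<^sub>R x) = c *\<^sub>R T x) \<and>
        (\<exists>K. \<forall>x\<in>pts E. nrm F (T x) \<le> K * nrm E x) \<and>
        (\<forall>x. x \<notin> pts E \<longrightarrow> T x = 0)}"

text \<open>As for \<^const>\<open>onorm\<close>, the quotient at \<open>x = 0\<close> is \<open>0 / 0 = 0\<close>.\<close>

definition op_norm :: "'a nspace \<Rightarrow> 'b nspace \<Rightarrow> ('a \<Rightarrow> 'b) \<Rightarrow> real"
  where "op_norm E F T = (SUP x\<in>pts E. nrm F (T x) / nrm E x)"

definition dual :: "'a::real_vector nspace \<Rightarrow> ('a \<Rightarrow> real) nspace"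
  where "dual E =
    (let R = \<lparr>pts = UNIV, nrm = abs\<rparr> in \<lparr>pts = bounded_ops E R, nrm = op_norm E R\<rparr>)"

definition inv_op :: "'a nspace \<Rightarrow> 'b nspace \<Rightarrow> ('a \<Rightarrow> 'b) \<Rightarrow> 'b \<Rightarrow> 'a::real_vector"
  where "inv_op E F T = (\<lambda>y. if y \<in> pts F then inv_into (pts E) T y else 0)"

definition isomorphism :: "'a::real_vector nspace \<Rightarrow> 'b::real_vector nspace \<Rightarrow> ('a \<Rightarrow> 'b) \<Rightarrow> bool"
  where "isomorphism E F T \<longleftrightarrow>
    T \<in> bounded_ops E F \<and> bij_betw T (pts E) (pts F) \<and> inv_op E F T \<in> bounded_ops F E"

definition cond_num :: "'a::real_vector nspace \<Rightarrow> 'b nspace \<Rightarrow> ('a \<Rightarrow> 'b) \<Rightarrow> real"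
  where "cond_num E F T = op_norm E F T * op_norm F E (inv_op E F T)"

definition eigenvalues :: "'a::real_vector nspace \<Rightarrow> ('a \<Rightarrow> 'a) \<Rightarrow> real set"
  where "eigenvalues E T = {l. \<exists>x\<in>pts E. x \<noteq> 0 \<and> T x = l *\<^sub>R x}"

text \<open>
  An operator \<open>B : X \<rightarrow> Y'\<close> is a curried function with \<open>\<langle>B x, y\<rangle> = B x y\<close>. Since \<open>B x y = 0\<close> unless
  \<open>x \<in> X\<close> and \<open>y \<in> Y\<close>, swapping the arguments is the adjoint \<open>B' : Y \<rightarrow> X'\<close>, without reference to
  the carriers.
\<close>

definition dual_adjoint :: "('a \<Rightarrow> 'b \<Rightarrow> real) \<Rightarrow> 'b \<Rightarrow> 'a \<Rightarrow> real"
  where "dual_adjoint B = (\<lambda>y x. B x y)"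

definition hilbert :: "'a::real_inner set \<Rightarrow> 'a nspace"
  where "hilbert V = \<lparr>pts = V, nrm = norm\<rparr>"

text \<open>
  Indices run from 1, so \<open>schur X A B i\<close> is \<open>S\<^sub>i\<close> for \<open>i \<ge> 1\<close>; the value at 0 is a dummy.
\<close>

fun schur :: "(nat \<Rightarrow> 'a::real_inner set) \<Rightarrow> (nat \<Rightarrow> 'a \<Rightarrow> 'a \<Rightarrow> real) \<Rightarrow> (nat \<Rightarrow> 'a \<Rightarrow> 'a \<Rightarrow> real)
    \<Rightarrow> nat \<Rightarrow> 'a \<Rightarrow> 'a \<Rightarrow> real"
  where
    "schur X A B 0 = 0"
  | "schur X A B (Suc 0) = A 1"
  | "schur X A B (Suc (Suc i)) =
      A (Suc (Suc i)) +
      (B (Suc i) \<circ> inv_op (hilbert (X (Suc i))) (dual (hilbert (X (Suc i)))) (schur X A B (Suc i))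
        \<circ> dual_adjoint (B (Suc i)))"

definition prod_space :: "nat \<Rightarrow> (nat \<Rightarrow> 'a::zero set) \<Rightarrow> (nat \<Rightarrow> 'a) set"
  where "prod_space n X = {x. (\<forall>i\<in>{1..n}. x i \<in> X i) \<and> (\<forall>i. i \<notin> {1..n} \<longrightarrow> x i = 0)}"

text \<open>
  The operator from the product to its dual given by the block matrix with entries
  \<open>T i j : X j \<rightarrow> (X i)'\<close>, where \<open>(X 1)' \<times> \<dots> \<times> (X n)'\<close> is identified with the dual of the product.
\<close>

definition block_op :: "nat \<Rightarrow> (nat \<Rightarrow> 'a::zero set) \<Rightarrow> (nat \<Rightarrow> nat \<Rightarrow> 'a \<Rightarrow> 'a \<Rightarrow> real)
    \<Rightarrow> (nat \<Rightarrow> 'a) \<Rightarrow> (nat \<Rightarrow> 'a) \<Rightarrow> real"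
  where "block_op n X T = (\<lambda>x y.
    if x \<in> prod_space n X \<and> y \<in> prod_space n X
    then \<Sum>i=1..n. \<Sum>j=1..n. T i j (x j) (y i) else 0)"

definition tridiag_op :: "nat \<Rightarrow> (nat \<Rightarrow> 'a::zero set) \<Rightarrow> (nat \<Rightarrow> 'a \<Rightarrow> 'a \<Rightarrow> real)
    \<Rightarrow> (nat \<Rightarrow> 'a \<Rightarrow> 'a \<Rightarrow> real) \<Rightarrow> (nat \<Rightarrow> 'a) \<Rightarrow> (nat \<Rightarrow> 'a) \<Rightarrow> real"
  where "tridiag_op n X A B = block_op n X (\<lambda>i j.
    if i = j then (- 1) ^ (i - 1) *\<^sub>R A i
    else if i = j + 1 then B j
    else if j = i + 1 then dual_adjoint (B i)
    else 0)"

definition diag_op :: "nat \<Rightarrow> (nat \<Rightarrow> 'a::zero set) \<Rightarrow> (nat \<Rightarrow> 'a \<Rightarrow> 'a \<Rightarrow> real)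
    \<Rightarrow> (nat \<Rightarrow> 'a) \<Rightarrow> (nat \<Rightarrow> 'a) \<Rightarrow> real"
  where "diag_op n X S = block_op n X (\<lambda>i j. if i = j then S i else 0)"

end

(*
In the inner products induced by the Schur complements, S_{i+1} = B_i S_i^{-1} B_i' says that
C_i = S_i^{-1} B_i' is an isometry from X_{i+1} into X_i, with adjoint D_i = S_{i+1}^{-1} B_i and
D_i C_i = 1. So M is the block tridiagonal matrix with the C_i above and the D_i below the diagonal
and a single diagonal entry 1 in the first row. Pulling everything back to X_1, it is an orthogonal
sum of copies of the scalar j x j matrices T_j of the same shape, j = 1, ..., n, whose eigenvectors
are cos((k - 1/2) t) with eigenvalue 2 cos t, where cos((j + 1/2) t) = 0. The summand of size n is
split off first, and the rest is treated by induction.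

Both norm bounds come from one identity: for p q > 0,
|a + b|^2 <= (p + q) (|a|^2 / p + |b|^2 / q), and the inequality is reversed for p q < 0. Taking for
p, q the neighbouring entries of an eigenvector of T_n with eigenvalue l and summing over all rows
gives l^2 |x|^2 on the right. The eigenvector of the largest eigenvalue is positive, whence the
upper bound; in the one of the eigenvalue closest to 0, entries at distance two have opposite signs,
whence the lower bound.
*)

theory Submission
  imports Defs
begin

section \<open>Three-term recurrences and their trigonometric solutions\<close>

text \<open>The spaces may be infinite-dimensional, so the norms of M and of its inverse are not
  read off from the eigenvalues: both bounds are estimates of quadratic forms, and eigenvectors only
  show that they are attained. Those eigenvectors come from the summand of size n, which is present
  as soon as X_n is nonzero. The summand of size j < n lives on the kernel of D_j, which is that of
  B_j. It is missing if this kernel is zero, so in general there is only an inclusion, and equality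
  when all these kernels are nontrivial.

  The two bounds need different routes because D_i is merely a contraction. With positive weights
  the loss goes in the right direction, and one summation over the whole chain gives the upper
  bound. With weights of changing sign it cannot be controlled. The lower bound therefore splits the
  chain into scalar copies, where nothing is lost, and uses that shorter copies have their
  eigenvalues farther from 0.\<close>

lemma sum_three_term_commute:
  fixes f g :: "nat \<Rightarrow> real"
  shows "(\<Sum>i=1..m. f i * (g (i - 1) + g (Suc i))) - (\<Sum>i=1..m. g i * (f (i - 1) + f (Suc i)))
    = (f m * g (Suc m) - g m * f (Suc m)) - (f 0 * g 1 - g 0 * f 1)"
  by (induction m) (simp_all add: algebra_simps)

text \<open>The eigenvector equation of T_m with two ghost entries:
  \<open>\<psi> 0 = \<psi> 1\<close> stands for the diagonal entry 1 of the first row,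
  \<open>\<psi> (Suc m) = 0\<close> for the missing neighbour of the last row.\<close>

definition three_term :: "nat \<Rightarrow> real \<Rightarrow> (nat \<Rightarrow> real) \<Rightarrow> bool"
  where "three_term m l \<psi> \<longleftrightarrow> \<psi> 0 = \<psi> 1 \<and> \<psi> (Suc m) = 0 \<and>
    (\<forall>i\<in>{1..m}. \<psi> (i - 1) + \<psi> (Suc i) = l * \<psi> i)"

text \<open>The eigenvector equation is used twice, with a discrete Green identity in between that
  moves the neighbour sum from \<open>N / \<psi>\<close> to \<open>\<psi>\<close>. Its boundary
  terms cancel at 0, where both sequences repeat their first value, and vanish at
  \<open>Suc m\<close>, where \<open>N / \<psi>\<close> is \<open>0 / 0 = 0\<close>.\<close>

lemma three_term_weighted_sum:
  assumes \<psi>: "three_term m l \<psi>" "\<And>i. i \<in> {1..m} \<Longrightarrow> \<psi> i \<noteq> 0"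
    and N: "N 0 = N 1" "N (Suc m) = 0"
  shows "(\<Sum>i=1..m. (\<psi> (i - 1) + \<psi> (Suc i)) * (N (i - 1) / \<psi> (i - 1) + N (Suc i) / \<psi> (Suc i)))
    = l\<^sup>2 * (\<Sum>i=1..m. N i)"
proof -
  define g where "g i = N i / \<psi> i" for i
  have W: "(\<Sum>i=1..m. \<psi> i * (g (i - 1) + g (Suc i))) = (\<Sum>i=1..m. g i * (\<psi> (i - 1) + \<psi> (Suc i)))"
    using sum_three_term_commute[of \<psi> g m] \<psi>(1) N by (simp add: g_def three_term_def)
  have "(\<Sum>i=1..m. (\<psi> (i - 1) + \<psi> (Suc i)) * (g (i - 1) + g (Suc i)))
      = l * (\<Sum>i=1..m. \<psi> i * (g (i - 1) + g (Suc i)))"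
    unfolding sum_distrib_left using \<psi>(1) by (intro sum.cong) (auto simp: three_term_def)
  also have "\<dots> = l * (\<Sum>i=1..m. l * N i)"
    unfolding W using \<psi> by (intro arg_cong[where f="(*) l"] sum.cong) (auto simp: three_term_def g_def)
  finally show ?thesis
    by (simp add: g_def sum_distrib_left power2_eq_square mult.assoc)
qed

text \<open>The shift by 1/2 makes the cosine even about the midpoint of 0 and 1, which is the
  condition at the first end; the hypothesis is the zero at \<open>Suc m\<close>.\<close>

lemma cos_three_term:
  assumes "cos ((real m + 1 / 2) * \<theta>) = 0"
  shows "three_term m (2 * cos \<theta>) (\<lambda>k. cos ((real k - 1 / 2) * \<theta>))"
proof -
  have "cos ((real (i - 1) - 1 / 2) * \<theta>) + cos ((real (Suc i) - 1 / 2) * \<theta>)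
      = 2 * cos \<theta> * cos ((real i - 1 / 2) * \<theta>)" if "i \<in> {1..m}" for i
  proof -
    have "(real (i - 1) - 1 / 2) * \<theta> = (real i - 1 / 2) * \<theta> - \<theta>"
         "(real (Suc i) - 1 / 2) * \<theta> = (real i - 1 / 2) * \<theta> + \<theta>"
      using that by (auto simp: of_nat_diff algebra_simps)
    thus ?thesis by (simp only: cos_add cos_diff) simp
  qed
  moreover have "cos (- (1 / 2) * \<theta>) = cos ((1 - 1 / 2) * \<theta>)"
    by (simp add: cos_minus)
  ultimately show ?thesis
    using assms by (auto simp: three_term_def algebra_simps)
qed

section \<open>Zeros of cos((j + 1/2) t) and the signs of two eigenvectors\<close>

definition eig_angle :: "nat \<Rightarrow> nat \<Rightarrow> real"
  where "eig_angle j i = (2 * real i - 1) / (2 * real j + 1) * pi"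

lemma eig_angle_bounds:
  assumes "i \<in> {1..j}"
  shows "0 < eig_angle j i" "eig_angle j i < pi"
proof -
  have "(2 * real i - 1) / (2 * real j + 1) < 1" "0 < (2 * real i - 1) / (2 * real j + 1)"
    using assms by auto
  from mult_strict_right_mono[OF this(1) pi_gt_zero] mult_pos_pos[OF this(2) pi_gt_zero]
  show "0 < eig_angle j i" "eig_angle j i < pi"
    unfolding eig_angle_def by linarith+
qed

lemma cos_eig_angle:
  assumes "i \<in> {1..j}"
  shows "cos ((real j + 1 / 2) * eig_angle j i) = 0"
proof -
  have "(real j + 1 / 2) * eig_angle j i = real i * pi - pi / 2"
    by (simp add: eig_angle_def field_simps)
  thus ?thesis by (simp add: cos_diff)
qed

text \<open>The zeros of the cosine are the odd multiples of pi/2, and the open interval leaves the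
  odd numbers 1, 3, ..., 2j - 1.\<close>

lemma eig_angle_complete:
  assumes "0 < \<theta>" "\<theta> < pi" and c: "cos ((real j + 1 / 2) * \<theta>) = 0"
  shows "\<exists>i\<in>{1..j}. \<theta> = eig_angle j i"
proof -
  obtain k where k: "odd k" "(real j + 1 / 2) * \<theta> = of_int k * (pi / 2)"
    using c by (auto simp: cos_zero_iff_int)
  have eq: "(2 * real j + 1) * \<theta> = of_int k * pi"
    using k(2) by (simp add: field_simps)
  have "0 < (2 * real j + 1) * \<theta>" using assms by simp
  hence "0 < k" unfolding eq by (simp add: zero_less_mult_iff)
  have "(2 * real j + 1) * \<theta> < (2 * real j + 1) * pi" using assms by simp
  hence "real_of_int k < 2 * real j + 1" unfolding eq by simp
  hence "k < 2 * int j + 1" by linarith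
  obtain q where q: "k = 2 * q + 1" using k(1) by (rule oddE)
  define i where "i = nat q + 1"
  have "i \<in> {1..j}" "real_of_int k = 2 * real i - 1"
    using q \<open>0 < k\<close> \<open>k < 2 * int j + 1\<close> by (auto simp: i_def)
  moreover have "\<theta> = eig_angle j i"
    using eq calculation(2) by (simp add: eig_angle_def field_simps)
  ultimately show ?thesis by blast
qed

text \<open>The arguments are (2k - 1)/(2m + 1) times pi/2, so they stay below the first zero of the
  cosine.\<close>

lemma max_eigvec_pos:
  assumes "k \<in> {1..m}"
  shows "cos ((real k - 1 / 2) * eig_angle m 1) > 0"
proof (rule cos_gt_zero_pi)
  have "(real k - 1 / 2) * eig_angle m 1 = (2 * real k - 1) / (2 * real m + 1) * (pi / 2)"
    by (simp add: eig_angle_def field_simps)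
  moreover have "(2 * real k - 1) / (2 * real m + 1) < 1" "0 < (2 * real k - 1) / (2 * real m + 1)"
    using assms by auto
  from mult_strict_right_mono[OF this(1) pi_half_gt_zero] mult_pos_pos[OF this(2) pi_half_gt_zero]
  have "(2 * real k - 1) / (2 * real m + 1) * (pi / 2) < pi / 2"
    "- (pi / 2) < (2 * real k - 1) / (2 * real m + 1) * (pi / 2)"
    using pi_half_gt_zero by linarith+
  ultimately show "(real k - 1 / 2) * eig_angle m 1 < pi / 2"
    "- (pi / 2) < (real k - 1 / 2) * eig_angle m 1"
    by simp_all
qed

text \<open>The index of the eigenvalue of smallest modulus: its angle is the one closest to \<open>\<pi>/2\<close>.\<close>

definition mid :: "nat \<Rightarrow> nat"
  where "mid m = m div 2 + 1"

text \<open>The distance from pi/2 to the nearest angle \<open>eig_angle m i\<close>; consecutive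
  angles are four times as far apart.\<close>

definition half_gap :: "nat \<Rightarrow> real"
  where "half_gap m = pi / (2 * (2 * real m + 1))"

lemma half_gap_pos: "0 < half_gap m"
  by (simp add: half_gap_def)

lemma half_gap_le: "m \<le> n \<Longrightarrow> half_gap n \<le> half_gap m"
  by (simp add: half_gap_def frac_le)

lemma half_gap_total: "(2 * real m + 1) * half_gap m = pi / 2"
  by (simp add: half_gap_def field_simps)

lemma mult_half_gap_less:
  assumes "x < 2 * real m + 1"
  shows "x * half_gap m < pi / 2"
  using mult_strict_right_mono[OF assms half_gap_pos[of m]] by (simp only: half_gap_total)

lemma eig_angle_mid:
  "eig_angle m (mid m) = pi / 2 + (if even m then 1 else - 1) * half_gap m"
proof (cases "even m")
  case True
  then obtain q where "m = 2 * q" by blast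
  thus ?thesis by (simp add: eig_angle_def mid_def half_gap_def field_simps)
next
  case False
  then obtain q where "m = 2 * q + 1" by (rule oddE)
  thus ?thesis by (simp add: eig_angle_def mid_def half_gap_def field_simps)
qed

lemma mid_in: "m \<ge> 1 \<Longrightarrow> mid m \<in> {1..m}"
  by (auto simp: mid_def)

lemma abs_cos_eig_angle_mid: "\<bar>cos (eig_angle m (mid m))\<bar> = sin (half_gap m)"
proof -
  have "half_gap m \<le> pi / 2"
    by (simp add: half_gap_def field_simps)
  hence "0 \<le> sin (half_gap m)"
    using half_gap_pos[of m] by (intro sin_ge_zero) (auto intro: order_trans)
  thus ?thesis
    by (simp add: eig_angle_mid cos_add cos_diff)
qed

text \<open>The angle is pi/2 up to \<open>half_gap m\<close>. An odd multiple of pi/2 has cosine 0,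
  so only the sine of the multiplied shift survives, and the parity-dependent sign of the shift
  disappears under the absolute value.\<close>

lemma abs_cos_odd_mid_le:
  assumes "k \<ge> 1"
  shows "\<bar>cos ((2 * real k - 1) * eig_angle m (mid m))\<bar> \<le> \<bar>sin ((2 * real k - 1) * half_gap m)\<bar>"
proof -
  define e :: real where "e = (if even m then 1 else - 1)"
  have eq: "(2 * real k - 1) * eig_angle m (mid m)
      = (real k * pi - pi / 2) + e * ((2 * real k - 1) * half_gap m)"
    unfolding eig_angle_mid e_def by (simp add: field_simps)
  have "cos (real k * pi - pi / 2) = 0"
    by (simp add: cos_diff)
  hence "\<bar>cos ((2 * real k - 1) * eig_angle m (mid m))\<bar>
      = \<bar>sin (real k * pi - pi / 2)\<bar> * \<bar>sin (e * ((2 * real k - 1) * half_gap m))\<bar>"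
    by (simp only: eq cos_add) (simp add: abs_mult)
  also have "\<dots> \<le> 1 * \<bar>sin (e * ((2 * real k - 1) * half_gap m))\<bar>"
    by (intro mult_right_mono abs_sin_le_one) auto
  also have "\<dots> = \<bar>sin ((2 * real k - 1) * half_gap m)\<bar>"
    by (simp add: e_def)
  finally show ?thesis .
qed

text \<open>A zero of the cosine would give the doubled argument the cosine -1. The doubled argument
  is an odd multiple of the angle, so its cosine is bounded by the sine of some t strictly between 0
  and pi/2.\<close>

lemma mid_eigvec_nonzero:
  assumes "k \<in> {1..m}"
  shows "cos ((real k - 1 / 2) * eig_angle m (mid m)) \<noteq> 0"
proof -
  define t where "t = (2 * real k - 1) * half_gap m"
  have "0 < t" "t < pi / 2"
    using assms mult_half_gap_less[of "2 * real k - 1" m] by (auto simp: t_def half_gap_pos)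
  hence "\<bar>sin t\<bar> < 1"
    using sin_monotone_2pi[of t "pi / 2"] sin_gt_zero2[of t] by simp
  hence "cos ((2 * real k - 1) * eig_angle m (mid m)) > - 1"
    using abs_cos_odd_mid_le[of k m] assms by (simp add: t_def)
  moreover have "(2 * real k - 1) * eig_angle m (mid m) = 2 * ((real k - 1 / 2) * eig_angle m (mid m))"
    by (simp add: algebra_simps)
  ultimately show ?thesis
    by (auto simp only: cos_double_cos) auto
qed

text \<open>Twice the product is the cosine of the sum plus the cosine of the difference of the
  arguments. The difference is 2b, with cosine \<open>- cos (2 * half_gap m)\<close>; the sum is (2k
  - 1) b, an odd multiple whose cosine is too small to compensate.\<close>

lemma mid_eigvec_sign_change:
  assumes "k \<in> {1..<m}"
  shows "cos ((real (k - 1) - 1 / 2) * eig_angle m (mid m)) *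
    cos ((real (Suc k) - 1 / 2) * eig_angle m (mid m)) < 0"
proof -
  define b where "b = eig_angle m (mid m)"
  define t where "t = (2 * real k - 1) * half_gap m"
  have pos: "0 < t" using assms by (auto simp: t_def half_gap_pos)
  have "t + 2 * half_gap m = (2 * real k + 1) * half_gap m"
    by (simp add: t_def algebra_simps)
  \<comment> \<open>Here \<open>k < m\<close> enters: it is what makes 2k + 1 smaller than 2m +
    1.\<close>
  hence lt: "t < pi / 2 - 2 * half_gap m"
    using assms mult_half_gap_less[of "2 * real k + 1" m] by simp
  have "sin t < sin (pi / 2 - 2 * half_gap m)"
    using pos lt half_gap_pos[of m] by (intro sin_monotone_2pi) auto
  also have "\<dots> = cos (2 * half_gap m)"
    by (simp add: sin_diff)
  also have "\<dots> = - cos (2 * b)"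
  proof -
    have "2 * b = pi + (if even m then 1 else - 1) * (2 * half_gap m)"
      by (simp add: b_def eig_angle_mid)
    thus ?thesis by (simp add: cos_add cos_diff split: if_splits)
  qed
  finally have "sin t < - cos (2 * b)" .
  moreover have "0 < sin t"
    using pos lt half_gap_pos[of m] by (intro sin_gt_zero2) auto
  ultimately have "cos ((2 * real k - 1) * b) + cos (2 * b) < 0"
    using abs_cos_odd_mid_le[of k m] assms by (simp add: t_def b_def)
  moreover have "(2 * real k - 1) * b = (real (k - 1) - 1 / 2) * b + (real (Suc k) - 1 / 2) * b"
    "2 * b = (real (Suc k) - 1 / 2) * b - (real (k - 1) - 1 / 2) * b"
    using assms by (auto simp: of_nat_diff algebra_simps)
  ultimately show ?thesis
    unfolding b_def[symmetric] by (simp only: cos_add cos_diff) (simp add: algebra_simps)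
qed

section \<open>Inner product forms on subspaces\<close>

text \<open>A carrier in a mere real vector space lets the same locale serve the spaces
  \<open>X i\<close> with the Schur complements and the product space of tuples with their
  sum.\<close>

locale inner_form =
  fixes V :: "'a::real_vector set" and s :: "'a \<Rightarrow> 'a \<Rightarrow> real"
  assumes subspace: "subspace V"
    and sym: "x \<in> V \<Longrightarrow> y \<in> V \<Longrightarrow> s x y = s y x"
    and add_left: "x \<in> V \<Longrightarrow> y \<in> V \<Longrightarrow> z \<in> V \<Longrightarrow> s (x + y) z = s x z + s y z"
    and scale_left: "x \<in> V \<Longrightarrow> y \<in> V \<Longrightarrow> s (c *\<^sub>R x) y = c * s x y"
    and pos: "x \<in> V \<Longrightarrow> x \<noteq> 0 \<Longrightarrow> 0 < s x x"
begin

lemmas in_V = subspace_0[OF subspace] subspace_add[OF subspace] subspace_diff[OF subspace]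
  subspace_scale[OF subspace] subspace_neg[OF subspace]

lemma add_right: "x \<in> V \<Longrightarrow> y \<in> V \<Longrightarrow> z \<in> V \<Longrightarrow> s z (x + y) = s z x + s z y"
  using add_left sym in_V by metis

lemma scale_right: "x \<in> V \<Longrightarrow> y \<in> V \<Longrightarrow> s y (c *\<^sub>R x) = c * s y x"
  using scale_left sym in_V by metis

lemma minus_left: "x \<in> V \<Longrightarrow> y \<in> V \<Longrightarrow> s (- x) y = - s x y"
  using scale_left[of x y "-1"] by simp

lemma minus_right: "x \<in> V \<Longrightarrow> y \<in> V \<Longrightarrow> s y (- x) = - s y x"
  using scale_right[of x y "-1"] by simp

lemma diff_left: "x \<in> V \<Longrightarrow> y \<in> V \<Longrightarrow> z \<in> V \<Longrightarrow> s (x - y) z = s x z - s y z"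
  using add_left[of x "- y" z] by (simp add: in_V minus_left)

lemma diff_right: "x \<in> V \<Longrightarrow> y \<in> V \<Longrightarrow> z \<in> V \<Longrightarrow> s z (x - y) = s z x - s z y"
  using add_right[of x "- y" z] by (simp add: in_V minus_right)

lemma zero_left [simp]: "y \<in> V \<Longrightarrow> s 0 y = 0"
  using scale_left[of 0 y 0] by (simp add: in_V)

lemma zero_right [simp]: "y \<in> V \<Longrightarrow> s y 0 = 0"
  using scale_right[of 0 y 0] by (simp add: in_V)

lemma nonneg: "x \<in> V \<Longrightarrow> 0 \<le> s x x"
  using pos[of x] by (cases "x = 0") (auto simp: in_V)

lemma eq_0_iff: "x \<in> V \<Longrightarrow> s x x = 0 \<longleftrightarrow> x = 0"
  using pos[of x] by (cases "x = 0") (auto simp: in_V)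

lemma eqI:
  assumes "x \<in> V" "y \<in> V" "\<And>z. z \<in> V \<Longrightarrow> s z x = s z y"
  shows "x = y"
proof -
  have "s (x - y) (x - y) = 0"
    using assms by (simp add: diff_right in_V)
  thus ?thesis using assms eq_0_iff[of "x - y"] by (simp add: in_V)
qed

text \<open>The error term is a square divided by \<open>p * q\<close>, so the sign of
  \<open>p * q\<close> alone decides the direction of the inequality.\<close>

lemma weighted_add:
  assumes "a \<in> V" "b \<in> V" "p \<noteq> 0" "q \<noteq> 0"
  shows "(p + q) * (s a a / p + s b b / q)
    = s (a + b) (a + b) + s (q *\<^sub>R a - p *\<^sub>R b) (q *\<^sub>R a - p *\<^sub>R b) / (p * q)"
  using assms sym[of b a]
  by (simp add: add_left add_right diff_left diff_right scale_left scale_right in_V field_simps power2_eq_square)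

lemma weighted_add_upper:
  assumes "a \<in> V" "b \<in> V" "p > 0" "q > 0"
  shows "s (a + b) (a + b) \<le> (p + q) * (s a a / p + s b b / q)"
proof -
  have "0 \<le> s (q *\<^sub>R a - p *\<^sub>R b) (q *\<^sub>R a - p *\<^sub>R b) / (p * q)"
    using assms by (intro divide_nonneg_pos nonneg) (auto simp: in_V)
  thus ?thesis using weighted_add[OF assms(1,2), of p q] assms by linarith
qed

lemma weighted_add_lower:
  assumes "a \<in> V" "b \<in> V" "p * q < 0"
  shows "(p + q) * (s a a / p + s b b / q) \<le> s (a + b) (a + b)"
proof -
  have "s (q *\<^sub>R a - p *\<^sub>R b) (q *\<^sub>R a - p *\<^sub>R b) / (p * q) \<le> 0"
    using assms by (intro divide_nonneg_neg nonneg) (auto simp: in_V)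
  moreover have "p \<noteq> 0" "q \<noteq> 0" using assms(3) by auto
  ultimately show ?thesis using weighted_add[OF assms(1,2), of p q] by linarith
qed

lemma cauchy_schwarz:
  assumes "x \<in> V" "y \<in> V"
  shows "\<bar>s x y\<bar> \<le> sqrt (s x x) * sqrt (s y y)"
proof (cases "y = 0")
  case False
  hence p: "0 < s y y" using assms pos by blast
  define t where "t = s x y / s y y"
  have "0 \<le> s (x - t *\<^sub>R y) (x - t *\<^sub>R y)"
    using assms by (intro nonneg) (auto simp: in_V)
  also have "\<dots> = s x x - (s x y)\<^sup>2 / s y y"
    using assms p sym[of y x]
    by (simp add: diff_left diff_right scale_left scale_right in_V t_def field_simps power2_eq_square)
  finally have "(s x y)\<^sup>2 \<le> s x x * s y y"
    using p by (simp add: field_simps)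
  hence "sqrt ((s x y)\<^sup>2) \<le> sqrt (s x x * s y y)" by (rule real_sqrt_le_mono)
  thus ?thesis by (simp add: real_sqrt_mult)
qed (use assms in simp)

end

context inner_form
begin

text \<open>The lower bound for a scalar copy: all \<open>z i\<close> lie in one space, so every row
  is a sum of two neighbours without any operator in between, and the weights may have either
  sign.\<close>

lemma path_lower:
  assumes \<psi>: "three_term m l \<psi>" "\<And>i. i \<in> {1..m} \<Longrightarrow> \<psi> i \<noteq> 0"
    "\<And>i. i \<in> {1..<m} \<Longrightarrow> \<psi> (i - 1) * \<psi> (Suc i) < 0"
    and z: "\<And>i. i \<in> {1..m} \<Longrightarrow> z i \<in> V"
    and Tz: "\<And>i. i \<in> {1..m} \<Longrightarrow>
      Tz i = (if i = 1 then z 1 else z (i - 1)) + (if i < m then z (Suc i) else 0)"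
  shows "l\<^sup>2 * (\<Sum>i=1..m. s (z i) (z i)) \<le> (\<Sum>i=1..m. s (Tz i) (Tz i))"
proof (cases "m = 0")
  case False
  \<comment> \<open>The ghost value at 0 repeats that at 1, because row 1 contains
    \<open>z 1\<close> itself in place of a predecessor.\<close>
  define N where "N k = (if k = 0 then s (z 1) (z 1) else if k \<le> m then s (z k) (z k) else 0)" for k
  have "l\<^sup>2 * (\<Sum>i=1..m. s (z i) (z i)) = l\<^sup>2 * (\<Sum>i=1..m. N i)"
    by (simp add: N_def)
  also have "\<dots> = (\<Sum>i=1..m. (\<psi> (i - 1) + \<psi> (Suc i)) * (N (i - 1) / \<psi> (i - 1) + N (Suc i) / \<psi> (Suc i)))"
    using False by (intro three_term_weighted_sum[symmetric] \<psi>) (auto simp: N_def)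
  also have "\<dots> \<le> (\<Sum>i=1..m. s (Tz i) (Tz i))"
  proof (rule sum_mono)
    fix i assume i: "i \<in> {1..m}"
    define a where "a = (if i = 1 then z 1 else z (i - 1))"
    have a: "a \<in> V" "N (i - 1) = s a a"
      using i z[of 1] z[of "i - 1"] by (auto simp: a_def N_def Suc_le_eq)
    show "(\<psi> (i - 1) + \<psi> (Suc i)) * (N (i - 1) / \<psi> (i - 1) + N (Suc i) / \<psi> (Suc i)) \<le> s (Tz i) (Tz i)"
    proof (cases "i < m")
      case True
      thus ?thesis using i a z[of "Suc i"] Tz[OF i] weighted_add_lower[of a "z (Suc i)", OF _ _ \<psi>(3)[of i]]
        by (auto simp: a_def N_def)
    next
      \<comment> \<open>In the last row the weight at \<open>Suc m\<close> is 0 and division by it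
        yields 0. The nonzero weight at \<open>i - 1\<close> cancels, and the two sides are
        equal.\<close>
      case F: False
      hence "\<psi> (i - 1) \<noteq> 0"
        using i \<psi>(1) \<psi>(2)[of 1] \<psi>(2)[of "i - 1"] by (cases "i = 1") (auto simp: three_term_def Suc_le_eq)
      moreover have "\<psi> (Suc i) = 0" using F i \<psi>(1) by (auto simp: three_term_def)
      ultimately show ?thesis using F i a Tz[OF i] by (auto simp: a_def)
    qed
  qed
  finally show ?thesis .
qed simp

end

text \<open>A recurrence of order two with equal values at 0 and 1 is determined by
  \<open>z 1\<close>, so \<open>z\<close> is a scalar cosine sequence times the vector
  \<open>z 1\<close>. If \<open>z\<close> is nonzero, so is \<open>z 1\<close>, and the end
  condition passes to the scalar sequence.\<close>

lemma path_eigenvalue: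
  fixes z :: "nat \<Rightarrow> 'a::real_vector"
  assumes Tz: "\<And>i. i \<in> {1..m} \<Longrightarrow>
      (if i = 1 then z 1 else z (i - 1)) + (if i < m then z (Suc i) else 0) = (2 * cos \<theta>) *\<^sub>R z i"
    and nz: "\<exists>i\<in>{1..m}. z i \<noteq> 0" and \<theta>: "0 < \<theta>" "\<theta> < pi"
  shows "cos ((real m + 1 / 2) * \<theta>) = 0"
proof -
  define Z where "Z k = (if k = 0 then z 1 else if k \<le> m then z k else 0)" for k
  define \<psi> where "\<psi> k = cos ((real k - 1 / 2) * \<theta>)" for k
  have m: "m \<ge> 1" using nz by auto
  have c: "cos (\<theta> / 2) > 0" using \<theta> by (intro cos_gt_zero) auto
  have \<psi>rec: "\<psi> (Suc (Suc k)) = 2 * cos \<theta> * \<psi> (Suc k) - \<psi> k" for k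
  proof -
    have "(real k - 1 / 2) * \<theta> = (real k + 1 / 2) * \<theta> - \<theta>"
      "(real (Suc k) - 1 / 2) * \<theta> = (real k + 1 / 2) * \<theta>"
      "(real (Suc (Suc k)) - 1 / 2) * \<theta> = (real k + 1 / 2) * \<theta> + \<theta>"
      by (auto simp: algebra_simps)
    thus ?thesis unfolding \<psi>_def by (simp only: cos_add cos_diff) simp
  qed
  have Zrec: "Z (Suc (Suc k)) = (2 * cos \<theta>) *\<^sub>R Z (Suc k) - Z k" if "k < m" for k
    using Tz[of "Suc k"] that by (cases k) (auto simp: Z_def algebra_simps)
  have \<psi>01: "\<psi> 0 = cos (\<theta> / 2)" "\<psi> 1 = cos (\<theta> / 2)"
    by (simp_all add: \<psi>_def)
  \<comment> \<open>The factor \<open>cos (\<theta> / 2)\<close> is the common value of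
    \<open>\<psi> 0\<close> and \<open>\<psi> 1\<close>; it is positive, so it can be cancelled
    later.\<close>
  have Z: "k \<le> m \<Longrightarrow> cos (\<theta> / 2) *\<^sub>R Z k = \<psi> k *\<^sub>R z 1 \<and>
      cos (\<theta> / 2) *\<^sub>R Z (Suc k) = \<psi> (Suc k) *\<^sub>R z 1" for k
  proof (induction k)
    case 0
    show ?case using m \<psi>01 by (simp add: Z_def)
  next
    case (Suc k)
    hence IH: "cos (\<theta> / 2) *\<^sub>R Z k = \<psi> k *\<^sub>R z 1" "cos (\<theta> / 2) *\<^sub>R Z (Suc k) = \<psi> (Suc k) *\<^sub>R z 1"
      by auto
    have "cos (\<theta> / 2) *\<^sub>R Z (Suc (Suc k))
        = (2 * cos \<theta>) *\<^sub>R (cos (\<theta> / 2) *\<^sub>R Z (Suc k)) - cos (\<theta> / 2) *\<^sub>R Z k"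
      using Suc.prems by (simp add: Zrec scaleR_diff_right)
    also have "\<dots> = \<psi> (Suc (Suc k)) *\<^sub>R z 1"
      unfolding IH \<psi>rec by (simp add: scaleR_diff_left)
    finally show ?case using IH by simp
  qed
  have "z 1 \<noteq> 0"
  proof
    assume "z 1 = 0"
    hence "z i = 0" if "i \<in> {1..m}" for i
      using Z[of i] c that by (simp add: Z_def)
    thus False using nz by blast
  qed
  moreover have "\<psi> (Suc m) *\<^sub>R z 1 = 0"
    using Z[of m] by (simp add: Z_def)
  ultimately have "\<psi> (Suc m) = 0" by simp
  thus ?thesis by (simp add: \<psi>_def algebra_simps)
qed

section \<open>Chains of isometries\<close>

text \<open>C_i and D_i are plain functions here. Their linearity and D_i C_i = 1 are derived by
  testing against all vectors, since the forms are definite.\<close>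

locale isometric_chain =
  fixes n :: nat and X :: "nat \<Rightarrow> 'a::real_vector set" and s :: "nat \<Rightarrow> 'a \<Rightarrow> 'a \<Rightarrow> real"
    and C D :: "nat \<Rightarrow> 'a \<Rightarrow> 'a"
  assumes form: "1 \<le> i \<Longrightarrow> i \<le> n \<Longrightarrow> inner_form (X i) (s i)"
    and C_in: "1 \<le> i \<Longrightarrow> i < n \<Longrightarrow> y \<in> X (Suc i) \<Longrightarrow> C i y \<in> X i"
    and D_in: "1 \<le> i \<Longrightarrow> i < n \<Longrightarrow> x \<in> X i \<Longrightarrow> D i x \<in> X (Suc i)"
    and adjoint: "1 \<le> i \<Longrightarrow> i < n \<Longrightarrow> x \<in> X i \<Longrightarrow> y \<in> X (Suc i) \<Longrightarrow> s i (C i y) x = s (Suc i) y (D i x)"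
    and isometry: "1 \<le> i \<Longrightarrow> i < n \<Longrightarrow> y \<in> X (Suc i) \<Longrightarrow> z \<in> X (Suc i) \<Longrightarrow>
      s i (C i y) (C i z) = s (Suc i) y z"
begin

lemmas in_X = inner_form.in_V[OF form]

lemma D_C:
  assumes "1 \<le> i" "i < n" "y \<in> X (Suc i)"
  shows "D i (C i y) = y"
  by (rule inner_form.eqI[OF form[of "Suc i"]])
    (use assms in \<open>auto simp: C_in D_in adjoint[symmetric] isometry\<close>)

lemma D_add:
  assumes "1 \<le> i" "i < n" "x \<in> X i" "y \<in> X i"
  shows "D i (x + y) = D i x + D i y"
  by (rule inner_form.eqI[OF form[of "Suc i"]])
    (use assms in \<open>auto simp: in_X C_in D_in adjoint[symmetric] inner_form.add_right[OF form]\<close>)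

lemma D_scale:
  assumes "1 \<le> i" "i < n" "x \<in> X i"
  shows "D i (c *\<^sub>R x) = c *\<^sub>R D i x"
  by (rule inner_form.eqI[OF form[of "Suc i"]])
    (use assms in \<open>auto simp: in_X C_in D_in adjoint[symmetric] inner_form.scale_right[OF form]\<close>)

lemma D_diff:
  assumes "1 \<le> i" "i < n" "x \<in> X i" "y \<in> X i"
  shows "D i (x - y) = D i x - D i y"
  using assms D_add[of i x "- 1 *\<^sub>R y"] D_scale[of i y "- 1"] by (simp add: in_X)

lemma adjoint':
  assumes "1 \<le> i" "i < n" "x \<in> X i" "y \<in> X (Suc i)"
  shows "s i x (C i y) = s (Suc i) (D i x) y"
  using assms adjoint[of i x y] inner_form.sym[OF form[of i], of x "C i y"]
    inner_form.sym[OF form[of "Suc i"], of "D i x" y] by (simp add: C_in D_in)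

lemma C_add:
  assumes "1 \<le> i" "i < n" "x \<in> X (Suc i)" "y \<in> X (Suc i)"
  shows "C i (x + y) = C i x + C i y"
  by (rule inner_form.eqI[OF form[of i]])
    (use assms in \<open>auto simp: in_X C_in D_in adjoint' inner_form.add_right[OF form]\<close>)

lemma C_scale:
  assumes "1 \<le> i" "i < n" "x \<in> X (Suc i)"
  shows "C i (c *\<^sub>R x) = c *\<^sub>R C i x"
  by (rule inner_form.eqI[OF form[of i]])
    (use assms in \<open>auto simp: in_X C_in D_in adjoint' inner_form.scale_right[OF form]\<close>)

lemma C_diff:
  assumes "1 \<le> i" "i < n" "x \<in> X (Suc i)" "y \<in> X (Suc i)"
  shows "C i (x - y) = C i x - C i y"
  using assms C_add[of i x "- 1 *\<^sub>R y"] C_scale[of i y "- 1"] by (simp add: in_X)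

text \<open>\<open>C i (D i x)\<close> is the orthogonal projection of \<open>x\<close> onto the
  image of \<open>C i\<close>, and its length is that of \<open>D i x\<close>.\<close>

lemma D_contraction:
  assumes "1 \<le> i" "i < n" "x \<in> X i"
  shows "s (Suc i) (D i x) (D i x) \<le> s i x x"
proof -
  interpret F: inner_form "X i" "s i" using assms by (intro form) auto
  have "0 \<le> s i (x - C i (D i x)) (x - C i (D i x))"
    using assms by (intro F.nonneg) (auto simp: F.in_V C_in D_in)
  also have "\<dots> = s i x x - s (Suc i) (D i x) (D i x)"
    using assms by (simp add: F.diff_left F.diff_right F.in_V C_in D_in adjoint adjoint' isometry D_C D_diff inner_form.zero_left[OF form])
  finally show ?thesis by simp
qed

text \<open>\<open>dn k i\<close> is the isometry C_i ... C_(i+k-1) from \<open>X (i + k)\<close>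
  into \<open>X i\<close>, and \<open>up k i\<close> is its adjoint. Both recursions fix the far end
  \<open>i + k\<close>, so that components of different blocks can be compared in one space.\<close>

primrec dn :: "nat \<Rightarrow> nat \<Rightarrow> 'a \<Rightarrow> 'a" where
  "dn 0 i y = y"
| "dn (Suc k) i y = C i (dn k (Suc i) y)"

primrec up :: "nat \<Rightarrow> nat \<Rightarrow> 'a \<Rightarrow> 'a" where
  "up 0 i x = x"
| "up (Suc k) i x = up k (Suc i) (D i x)"

lemma dn_in: "1 \<le> i \<Longrightarrow> i + k \<le> n \<Longrightarrow> y \<in> X (i + k) \<Longrightarrow> dn k i y \<in> X i"
  by (induction k arbitrary: i) (auto simp: C_in)

lemma up_in: "1 \<le> i \<Longrightarrow> i + k \<le> n \<Longrightarrow> x \<in> X i \<Longrightarrow> up k i x \<in> X (i + k)"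
proof (induction k arbitrary: i x)
  case (Suc k)
  thus ?case using Suc.IH[of "Suc i" "D i x"] by (simp add: D_in)
qed simp

lemma up_dn: "1 \<le> i \<Longrightarrow> i + k \<le> n \<Longrightarrow> y \<in> X (i + k) \<Longrightarrow> up k i (dn k i y) = y"
  by (induction k arbitrary: i) (auto simp: D_C dn_in)

lemma dn_adjoint:
  "1 \<le> i \<Longrightarrow> i + k \<le> n \<Longrightarrow> y \<in> X (i + k) \<Longrightarrow> x \<in> X i \<Longrightarrow> s i (dn k i y) x = s (i + k) y (up k i x)"
proof (induction k arbitrary: i x)
  case (Suc k)
  thus ?case using Suc.IH[of "Suc i" "D i x"] by (simp add: D_in dn_in adjoint)
qed simp

lemma up_add: "1 \<le> i \<Longrightarrow> i + k \<le> n \<Longrightarrow> x \<in> X i \<Longrightarrow> y \<in> X i \<Longrightarrow> up k i (x + y) = up k i x + up k i y"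
proof (induction k arbitrary: i x y)
  case (Suc k)
  thus ?case using Suc.IH[of "Suc i" "D i x" "D i y"] by (simp add: D_in D_add)
qed simp

lemma up_scale: "1 \<le> i \<Longrightarrow> i + k \<le> n \<Longrightarrow> x \<in> X i \<Longrightarrow> up k i (c *\<^sub>R x) = c *\<^sub>R up k i x"
proof (induction k arbitrary: i x)
  case (Suc k)
  thus ?case using Suc.IH[of "Suc i" "D i x"] by (simp add: D_in D_scale)
qed simp

lemma dn_add: "1 \<le> i \<Longrightarrow> i + k \<le> n \<Longrightarrow> x \<in> X (i + k) \<Longrightarrow> y \<in> X (i + k) \<Longrightarrow>
    dn k i (x + y) = dn k i x + dn k i y"
  by (induction k arbitrary: i) (auto simp: C_add dn_in)

lemma dn_scale: "1 \<le> i \<Longrightarrow> i + k \<le> n \<Longrightarrow> x \<in> X (i + k) \<Longrightarrow> dn k i (c *\<^sub>R x) = c *\<^sub>R dn k i x"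
  by (induction k arbitrary: i) (auto simp: C_scale dn_in)

lemma dn_zero: "1 \<le> i \<Longrightarrow> i + k \<le> n \<Longrightarrow> dn k i 0 = 0"
  using dn_scale[of i k 0 0] by (simp add: in_X)

lemma up_zero: "1 \<le> i \<Longrightarrow> i + k \<le> n \<Longrightarrow> up k i 0 = 0"
  using up_scale[of i k 0 0] by (simp add: in_X)

lemma dn_isometry:
  assumes "1 \<le> i" "i + k \<le> n" "y \<in> X (i + k)"
  shows "s i (dn k i y) (dn k i y) = s (i + k) y y"
  using assms by (simp add: dn_adjoint dn_in up_dn)

text \<open>\<open>dn k i\<close> after \<open>up k i\<close> is the orthogonal projection onto the
  image of the isometry \<open>dn k i\<close>.\<close>

lemma pythagoras:
  assumes "1 \<le> i" "i + k \<le> n" "x \<in> X i"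
  defines "u \<equiv> up k i x"
  shows "s i x x = s (i + k) u u + s i (x - dn k i u) (x - dn k i u)"
proof -
  interpret F: inner_form "X i" "s i" using assms by (intro form) auto
  have u: "u \<in> X (i + k)" "dn k i u \<in> X i" using assms by (auto simp: u_def up_in dn_in)
  show ?thesis
    using assms(1-3) u F.sym[of x "dn k i u"]
    by (simp add: F.diff_left F.diff_right F.in_V dn_isometry dn_adjoint u_def[symmetric] up_dn)
qed

text \<open>Row \<open>i\<close> of the block matrix with \<open>D\<close> below, \<open>C\<close> above and only the first diagonal block
  nonzero, cut off to the first \<open>m\<close> blocks.\<close>

definition lower_row :: "(nat \<Rightarrow> 'a) \<Rightarrow> nat \<Rightarrow> 'a"
  where "lower_row x i = (if i = 1 then x 1 else D (i - 1) (x (i - 1)))"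

definition upper_row :: "nat \<Rightarrow> (nat \<Rightarrow> 'a) \<Rightarrow> nat \<Rightarrow> 'a"
  where "upper_row m x i = (if i < m then C i (x (Suc i)) else 0)"

definition row :: "nat \<Rightarrow> (nat \<Rightarrow> 'a) \<Rightarrow> nat \<Rightarrow> 'a"
  where "row m x i = lower_row x i + upper_row m x i"

lemma lower_row_in:
  assumes "\<forall>i\<in>{1..m}. x i \<in> X i" "m \<le> n" "i \<in> {1..m}"
  shows "lower_row x i \<in> X i"
  using assms D_in[of "i - 1" "x (i - 1)"] by (auto simp: lower_row_def)

lemma upper_row_in:
  assumes "\<forall>i\<in>{1..m}. x i \<in> X i" "m \<le> n" "i \<in> {1..m}"
  shows "upper_row m x i \<in> X i"
  using assms by (auto simp: upper_row_def C_in in_X)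

lemma row_in:
  assumes "\<forall>i\<in>{1..m}. x i \<in> X i" "m \<le> n" "i \<in> {1..m}"
  shows "row m x i \<in> X i"
  using lower_row_in[OF assms] upper_row_in[OF assms] assms by (auto simp: row_def in_X)

text \<open>Row i is weighted by the neighbours \<open>\<psi> (i - 1)\<close> and
  \<open>\<psi> (Suc i)\<close>, after which the sum over the rows is the eigenvector identity for
  N.\<close>

lemma row_upper:
  assumes \<psi>: "three_term n l \<psi>" "\<And>i. i \<in> {1..n} \<Longrightarrow> \<psi> i > 0"
    and x: "\<forall>i\<in>{1..n}. x i \<in> X i"
  shows "(\<Sum>i=1..n. s i (row n x i) (row n x i)) \<le> l\<^sup>2 * (\<Sum>i=1..n. s i (x i) (x i))"
proof (cases "n = 0")
  case False
  define N where "N k = (if k = 0 then s 1 (x 1) (x 1) else if k \<le> n then s k (x k) (x k) else 0)" for k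
  have "(\<Sum>i=1..n. s i (row n x i) (row n x i))
    \<le> (\<Sum>i=1..n. (\<psi> (i - 1) + \<psi> (Suc i)) * (N (i - 1) / \<psi> (i - 1) + N (Suc i) / \<psi> (Suc i)))"
  proof (rule sum_mono)
    fix i assume i: "i \<in> {1..n}"
    interpret F: inner_form "X i" "s i" using i by (intro form) auto
    define a where "a = lower_row x i"
    have a: "a \<in> X i" using lower_row_in[OF x] i by (simp add: a_def)
    \<comment> \<open>Equality in row 1, where \<open>N 0\<close> is the ghost value; further down
      the contraction may lose something, which positive weights allow.\<close>
    have aN: "s i a a \<le> N (i - 1)"
      using i x D_contraction[of "i - 1" "x (i - 1)"] by (auto simp: a_def N_def lower_row_def)
    have p: "\<psi> (i - 1) > 0"
      using i \<psi>(1) \<psi>(2)[of 1] \<psi>(2)[of "i - 1"] by (cases "i = 1") (auto simp: three_term_def Suc_le_eq)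
    show "s i (row n x i) (row n x i)
      \<le> (\<psi> (i - 1) + \<psi> (Suc i)) * (N (i - 1) / \<psi> (i - 1) + N (Suc i) / \<psi> (Suc i))"
    proof (cases "i < n")
      case True
      define b where "b = C i (x (Suc i))"
      have b: "b \<in> X i" "s i b b = N (Suc i)"
        using True i x by (auto simp: b_def N_def C_in isometry)
      have q: "\<psi> (Suc i) > 0" using True \<psi>(2) by auto
      have "s i (row n x i) (row n x i) = s i (a + b) (a + b)"
        using True by (simp add: row_def upper_row_def a_def b_def)
      also have "\<dots> \<le> (\<psi> (i - 1) + \<psi> (Suc i)) * (s i a a / \<psi> (i - 1) + s i b b / \<psi> (Suc i))"
        using a b p q by (intro F.weighted_add_upper) auto
      also have "\<dots> \<le> (\<psi> (i - 1) + \<psi> (Suc i)) * (N (i - 1) / \<psi> (i - 1) + N (Suc i) / \<psi> (Suc i))"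
        using aN p q by (intro mult_left_mono add_mono divide_right_mono) (auto simp: b(2))
      finally show ?thesis .
    next
      case F: False
      hence "\<psi> (Suc i) = 0" using i \<psi>(1) by (auto simp: three_term_def)
      thus ?thesis using F aN p by (simp add: row_def upper_row_def a_def)
    qed
  qed
  also have "\<dots> = l\<^sup>2 * (\<Sum>i=1..n. N i)"
    using False \<psi> by (intro three_term_weighted_sum) (auto simp: N_def less_imp_neq[symmetric])
  also have "\<dots> = l\<^sup>2 * (\<Sum>i=1..n. s i (x i) (x i))"
    by (simp add: N_def)
  finally show ?thesis .
qed simp

text \<open>The subspace of all \<open>x\<close> with every component in the image of \<open>X (m+1)\<close> and its orthogonal
  complement are both invariant: on the former the rows act as a scalar tridiagonal matrix, on the
  latter as the chain of length \<open>m\<close>.\<close>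

lemma row_split:
  fixes x m
  defines "z \<equiv> \<lambda>i. up (Suc m - i) i (x i)"
  defines "w \<equiv> \<lambda>i. x i - dn (Suc m - i) i (z i)"
  defines "Tz \<equiv> \<lambda>i. (if i = 1 then z 1 else z (i - 1)) + (if i < Suc m then z (Suc i) else 0)"
  assumes x: "\<forall>i\<in>{1..Suc m}. x i \<in> X i" and m: "Suc m \<le> n" and i: "i \<in> {1..Suc m}"
  shows "z i \<in> X (Suc m)" "w i \<in> X i" "Tz i \<in> X (Suc m)"
    "up (Suc m - i) i (row (Suc m) x i) = Tz i"
    "row m w i = row (Suc m) x i - dn (Suc m - i) i (Tz i)"
proof -
  have z: "z j \<in> X (Suc m)" if "j \<in> {1..Suc m}" for j
    using that m x up_in[of j "Suc m - j" "x j"] by (auto simp: z_def)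
  have w: "w j \<in> X j" if "j \<in> {1..Suc m}" for j
    using that m x z[OF that] dn_in[of j "Suc m - j" "z j"] by (auto simp: w_def in_X)
  define k where "k = Suc m - i"
  define zl where "zl = (if i = 1 then z 1 else z (i - 1))"
  define zu where "zu = (if i < Suc m then z (Suc i) else 0)"
  have k: "i + k = Suc m" using i by (simp add: k_def)
  have zl: "zl \<in> X (Suc m)" and zu: "zu \<in> X (Suc m)"
    using z[of 1] z[of "i - 1"] z[of "Suc i"] i m by (auto simp: zl_def zu_def in_X Suc_le_eq)
  have l: "lower_row x i \<in> X i" and u: "upper_row (Suc m) x i \<in> X i"
    using lower_row_in[OF x m i] upper_row_in[OF x m i] by auto
  have up_l: "up k i (lower_row x i) = zl"
  proof (cases "i = 1")
    case False
    hence "Suc m - (i - 1) = Suc k" "Suc (i - 1) = i" using i by (auto simp: k_def)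
    thus ?thesis using False by (simp add: lower_row_def zl_def z_def)
  qed (simp add: lower_row_def zl_def z_def k_def)
  have up_u: "up k i (upper_row (Suc m) x i) = zu"
  proof (cases "i < Suc m")
    case True
    hence "k = Suc (Suc m - Suc i)" by (simp add: k_def)
    thus ?thesis using True i m x by (simp add: upper_row_def zu_def z_def D_C)
  next
    case False
    thus ?thesis using i m k by (simp add: upper_row_def zu_def up_zero)
  qed
  have w_l: "lower_row w i = lower_row x i - dn k i zl"
  proof (cases "i = 1")
    case False
    hence e: "Suc m - (i - 1) = Suc k" "Suc (i - 1) = i" using i by (auto simp: k_def)
    have "D (i - 1) (w (i - 1)) = D (i - 1) (x (i - 1)) - D (i - 1) (dn (Suc k) (i - 1) zl)"
      unfolding w_def e(1) using False i m x e k zl dn_in[of "i - 1" "Suc k" zl]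
      by (subst D_diff) (auto simp: zl_def simp del: dn.simps)
    also have "D (i - 1) (dn (Suc k) (i - 1) zl) = dn k i zl"
      using False i m e k zl by (simp add: D_C dn_in)
    finally show ?thesis using False by (simp add: lower_row_def)
  qed (simp add: lower_row_def zl_def w_def k_def)
  \<comment> \<open>For \<open>i = m\<close> the shorter chain has no upper entry. The right-hand
    side vanishes as well, since \<open>z (Suc m)\<close> is \<open>x (Suc m)\<close> and the single
    step of \<open>dn\<close> is \<open>C m\<close>.\<close>
  have w_u: "upper_row m w i = upper_row (Suc m) x i - dn k i zu"
  proof (cases "i < Suc m")
    case True
    hence e: "k = Suc (Suc m - Suc i)" by (simp add: k_def)
    have "dn k i zu = C i (dn (Suc m - Suc i) (Suc i) (z (Suc i)))"
      using True by (simp add: e zu_def)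
    moreover have "dn (Suc m - Suc i) (Suc i) (z (Suc i)) \<in> X (Suc i)"
      using True i m z[of "Suc i"] by (intro dn_in) auto
    ultimately show ?thesis
      using True i m x by (auto simp: upper_row_def w_def C_diff less_Suc_eq z_def)
  next
    case False
    thus ?thesis using i m k by (simp add: upper_row_def zu_def dn_zero)
  qed
  have Tz: "Tz i = zl + zu" by (simp add: Tz_def zl_def zu_def)
  show "z i \<in> X (Suc m)" "w i \<in> X i" using z w i by auto
  show "Tz i \<in> X (Suc m)" using zl zu m by (simp add: Tz in_X)
  show "up (Suc m - i) i (row (Suc m) x i) = Tz i"
    using i m k l u by (simp add: k_def[symmetric] row_def up_add up_l up_u Tz)
  show "row m w i = row (Suc m) x i - dn (Suc m - i) i (Tz i)"
    using i m k zl zu by (simp add: k_def[symmetric] row_def w_l w_u Tz dn_add)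
qed

text \<open>By Pythagoras both sums split into a scalar copy of size \<open>Suc m\<close> and a
  chain of length \<open>m\<close>. The copy has its own smallest eigenvalue as lower bound; the
  shorter chain has the induction hypothesis.\<close>

lemma row_lower:
  assumes "m \<le> n" "\<forall>i\<in>{1..m}. x i \<in> X i"
  shows "(2 * sin (half_gap m))\<^sup>2 * (\<Sum>i=1..m. s i (x i) (x i)) \<le> (\<Sum>i=1..m. s i (row m x i) (row m x i))"
  using assms
proof (induction m arbitrary: x)
  case (Suc m)
  define z where "z i = up (Suc m - i) i (x i)" for i
  define w where "w i = x i - dn (Suc m - i) i (z i)" for i
  define Tz where "Tz i = (if i = 1 then z 1 else z (i - 1)) + (if i < Suc m then z (Suc i) else 0)" for i
  define \<theta> where "\<theta> = eig_angle (Suc m) (mid (Suc m))"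
  note split = row_split[OF Suc.prems(2,1), folded z_def, folded w_def Tz_def]
  interpret F: inner_form "X (Suc m)" "s (Suc m)" using Suc.prems by (intro form) auto
  have w0: "w (Suc m) = 0" by (simp add: w_def z_def)
  have sums: "(\<Sum>i=1..Suc m. s i (x i) (x i))
      = (\<Sum>i=1..Suc m. s (Suc m) (z i) (z i)) + (\<Sum>i=1..m. s i (w i) (w i))"
  proof -
    have "s i (x i) (x i) = s (Suc m) (z i) (z i) + s i (w i) (w i)" if "i \<in> {1..Suc m}" for i
      using that Suc.prems pythagoras[of i "Suc m - i" "x i"] by (simp add: z_def w_def)
    hence "(\<Sum>i=1..Suc m. s i (x i) (x i)) = (\<Sum>i=1..Suc m. s (Suc m) (z i) (z i) + s i (w i) (w i))"
      by (rule sum.cong[OF refl])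
    thus ?thesis by (simp add: sum.distrib w0 F.in_V)
  qed
  have rows: "(\<Sum>i=1..Suc m. s i (row (Suc m) x i) (row (Suc m) x i))
      = (\<Sum>i=1..Suc m. s (Suc m) (Tz i) (Tz i)) + (\<Sum>i=1..m. s i (row m w i) (row m w i))"
  proof -
    have "s i (row (Suc m) x i) (row (Suc m) x i) = s (Suc m) (Tz i) (Tz i) + s i (row m w i) (row m w i)"
      if "i \<in> {1..Suc m}" for i
      using that Suc.prems pythagoras[of i "Suc m - i" "row (Suc m) x i"] row_in[OF Suc.prems(2,1) that]
        split(4,5)[OF that] by simp
    hence "(\<Sum>i=1..Suc m. s i (row (Suc m) x i) (row (Suc m) x i))
      = (\<Sum>i=1..Suc m. s (Suc m) (Tz i) (Tz i) + s i (row m w i) (row m w i))"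
      by (rule sum.cong[OF refl])
    moreover have "row m w (Suc m) = 0"
      using split(4,5)[of "Suc m"] by simp
    ultimately show ?thesis by (simp add: sum.distrib F.in_V)
  qed
  \<comment> \<open>The constant of the shorter chain is at least as large, so the copy of size
    \<open>Suc m\<close> determines the common bound.\<close>
  have "half_gap (Suc m) \<le> half_gap m" by (intro half_gap_le) simp
  moreover have "half_gap m \<le> pi / 2" by (simp add: half_gap_def field_simps)
  ultimately have sin: "sin (half_gap (Suc m)) \<le> sin (half_gap m)"
    using half_gap_pos[of "Suc m"] by (intro sin_monotone_2pi_le) (auto intro: order_trans[of _ 0])
  have "(2 * sin (half_gap (Suc m)))\<^sup>2 * (\<Sum>i=1..m. s i (w i) (w i))
      \<le> (2 * sin (half_gap m))\<^sup>2 * (\<Sum>i=1..m. s i (w i) (w i))"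
    using sin abs_cos_eig_angle_mid[of "Suc m"] Suc.prems split(2)
    by (intro mult_right_mono power_mono sum_nonneg inner_form.nonneg[OF form]) auto
  also have "\<dots> \<le> (\<Sum>i=1..m. s i (row m w i) (row m w i))"
    using Suc.prems split(2) by (intro Suc.IH) auto
  finally have W: "(2 * sin (half_gap (Suc m)))\<^sup>2 * (\<Sum>i=1..m. s i (w i) (w i))
      \<le> (\<Sum>i=1..m. s i (row m w i) (row m w i))" .
  have "(2 * cos \<theta>)\<^sup>2 * (\<Sum>i=1..Suc m. s (Suc m) (z i) (z i)) \<le> (\<Sum>i=1..Suc m. s (Suc m) (Tz i) (Tz i))"
  proof (rule F.path_lower)
    show "three_term (Suc m) (2 * cos \<theta>) (\<lambda>k. cos ((real k - 1 / 2) * \<theta>))"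
      unfolding \<theta>_def by (intro cos_three_term cos_eig_angle mid_in) simp
  qed (use split(1) mid_eigvec_nonzero mid_eigvec_sign_change in \<open>auto simp: \<theta>_def Tz_def simp del: of_nat_Suc\<close>)
  moreover have "(2 * cos \<theta>)\<^sup>2 = (2 * sin (half_gap (Suc m)))\<^sup>2"
    unfolding \<theta>_def abs_cos_eig_angle_mid[symmetric] by (simp add: power_mult_distrib)
  ultimately show ?case unfolding sums rows using W by (simp add: distrib_left)
qed simp

text \<open>If some \<open>z i\<close> is nonzero, \<open>z\<close> is an eigenvector of the scalar
  matrix of size \<open>Suc m\<close>. Otherwise \<open>x\<close> equals \<open>w\<close>, its last
  block vanishes, and it is an eigenvector of the shorter chain. The bound on \<open>l\<close>
  allows \<open>l = 2 * cos \<theta>\<close> with an angle strictly inside (0, pi).\<close>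

lemma row_eigenvalue:
  assumes "m \<le> n" "\<forall>i\<in>{1..m}. x i \<in> X i" "\<forall>i\<in>{1..m}. row m x i = l *\<^sub>R x i"
    "\<exists>i\<in>{1..m}. x i \<noteq> 0" "\<bar>l\<bar> < 2"
  shows "\<exists>j\<in>{1..m}. \<exists>i\<in>{1..j}. l = 2 * cos (eig_angle j i)"
  using assms
proof (induction m arbitrary: x)
  case (Suc m)
  define z where "z i = up (Suc m - i) i (x i)" for i
  define w where "w i = x i - dn (Suc m - i) i (z i)" for i
  define Tz where "Tz i = (if i = 1 then z 1 else z (i - 1)) + (if i < Suc m then z (Suc i) else 0)" for i
  note split = row_split[OF Suc.prems(2,1), folded z_def, folded w_def Tz_def]
  have Tz: "Tz i = l *\<^sub>R z i" if "i \<in> {1..Suc m}" for i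
    using that split(4)[OF that] Suc.prems by (simp add: up_scale z_def)
  show ?case
  proof (cases "\<exists>i\<in>{1..Suc m}. z i \<noteq> 0")
    case True
    define \<theta> where "\<theta> = arccos (l / 2)"
    have l: "l = 2 * cos \<theta>" using Suc.prems(5) by (simp add: \<theta>_def cos_arccos_abs)
    have \<theta>: "0 < \<theta>" "\<theta> < pi" using Suc.prems(5) by (auto simp: \<theta>_def arccos_lt_bounded)
    have "cos ((real (Suc m) + 1 / 2) * \<theta>) = 0"
      using Tz True \<theta> by (intro path_eigenvalue[where z=z]) (auto simp: Tz_def l)
    from eig_angle_complete[OF \<theta> this] show ?thesis using l by auto
  next
    case False
    hence wx: "w i = x i" if "i \<in> {1..Suc m}" for i
      using that Suc.prems by (auto simp: w_def dn_zero)
    have x0: "x (Suc m) = 0" using False by (force simp: z_def)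
    have "row m w i = l *\<^sub>R w i" if "i \<in> {1..m}" for i
      using that Suc.prems split(5)[of i] False Tz[of i] by (auto simp: wx dn_zero)
    moreover have "\<exists>i\<in>{1..m}. w i \<noteq> 0"
    proof -
      obtain i where "i \<in> {1..Suc m}" "x i \<noteq> 0" using Suc.prems(4) by blast
      thus ?thesis using x0 wx[of i] by (intro bexI[of _ i]) (auto simp: le_Suc_eq)
    qed
    ultimately have "\<exists>j\<in>{1..m}. \<exists>i\<in>{1..j}. l = 2 * cos (eig_angle j i)"
      using Suc.prems split(2) by (intro Suc.IH[of w]) auto
    thus ?thesis by auto
  qed
qed simp

text \<open>An eigenvector of the scalar matrix of size \<open>j\<close> tensored with a vector of \<open>X j\<close> that is
  annihilated by the next operator of the chain.\<close>

lemma row_eigenvector: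
  assumes j: "j \<in> {1..n}" and i: "i \<in> {1..j}"
    and v: "v \<in> X j" "v \<noteq> 0" "j < n \<Longrightarrow> D j v = 0"
  defines "x \<equiv> \<lambda>k. if k \<in> {1..j} then cos ((real k - 1 / 2) * eig_angle j i) *\<^sub>R dn (j - k) k v else 0"
  shows "\<forall>k\<in>{1..n}. x k \<in> X k" "x 1 \<noteq> 0"
    "\<forall>k\<in>{1..n}. row n x k = (2 * cos (eig_angle j i)) *\<^sub>R x k"
proof -
  define \<theta> where "\<theta> = eig_angle j i"
  define \<psi> where "\<psi> k = cos ((real k - 1 / 2) * \<theta>)" for k
  have rec: "three_term j (2 * cos \<theta>) \<psi>"
    unfolding \<psi>_def \<theta>_def by (intro cos_three_term cos_eig_angle i)
  have x: "x k = (if k \<in> {1..j} then \<psi> k *\<^sub>R dn (j - k) k v else 0)" for k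
    by (simp add: x_def \<psi>_def \<theta>_def)
  have dn: "dn (j - k) k v \<in> X k" if "k \<in> {1..j}" for k
    using that j v by (intro dn_in) auto
  show x_in: "\<forall>k\<in>{1..n}. x k \<in> X k"
    using dn by (auto simp: x in_X)
  have "cos (\<theta> / 2) > 0" using eig_angle_bounds[OF i] by (intro cos_gt_zero) (auto simp: \<theta>_def)
  moreover have "\<psi> 1 = cos (\<theta> / 2)" by (simp add: \<psi>_def)
  moreover have "dn (j - 1) 1 v \<noteq> 0"
    using up_dn[of 1 "j - 1" v] v j up_zero[of 1 "j - 1"] by auto
  ultimately show "x 1 \<noteq> 0" using j by (simp add: x)
  have l: "lower_row x k = \<psi> (k - 1) *\<^sub>R dn (j - k) k v" if "k \<in> {1..j}" for k
  proof (cases "k = 1")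
    case True
    thus ?thesis using rec that by (simp add: lower_row_def x three_term_def)
  next
    case False
    define q where "q = k - 1"
    have q: "k = Suc q" "1 \<le> q" "j - q = Suc (j - Suc q)" using that False by (auto simp: q_def)
    show ?thesis using that q j dn[of q] dn[of "Suc q"]
      by (simp add: lower_row_def x D_scale D_C del: dn.simps) (simp add: q D_C)
  qed
  have u: "upper_row n x k = \<psi> (Suc k) *\<^sub>R dn (j - k) k v" if "k \<in> {1..j}" for k
  proof (cases "k = j")
    case True
    thus ?thesis using rec j C_scale[of j 0 0] by (auto simp: upper_row_def x three_term_def in_X)
  next
    case False
    have q: "j - k = Suc (j - Suc k)" using that False by auto
    show ?thesis using that False j dn[of "Suc k"] by (auto simp: upper_row_def x C_scale q)
  qed
  show "\<forall>k\<in>{1..n}. row n x k = (2 * cos (eig_angle j i)) *\<^sub>R x k"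
  proof
    fix k assume k: "k \<in> {1..n}"
    consider "k \<le> j" | "k = Suc j" | "k > Suc j" by linarith
    thus "row n x k = (2 * cos (eig_angle j i)) *\<^sub>R x k"
    proof cases
      case 1
      hence kj: "k \<in> {1..j}" using k by auto
      hence "\<psi> (k - 1) + \<psi> (Suc k) = 2 * cos \<theta> * \<psi> k" using rec by (simp add: three_term_def)
      thus ?thesis using kj
        by (simp add: row_def l u x scaleR_add_left[symmetric] \<theta>_def)
    next
      case 2
      \<comment> \<open>Only in row \<open>Suc j\<close> can the vector leave the first
        \<open>j\<close> blocks; this is where \<open>v\<close> in the kernel of \<open>D j\<close>
        is used.\<close>
      have "D j (x j) = 0" using 2 k j v by (simp add: x D_scale)
      thus ?thesis using 2 k j C_scale[of k 0 0] by (auto simp: row_def lower_row_def upper_row_def x in_X)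
    next
      case 3
      thus ?thesis using k j C_scale[of k 0 0] D_scale[of "k - 1" 0 0]
        by (auto simp: row_def lower_row_def upper_row_def x in_X)
    qed
  qed
qed

text \<open>The forward sweep. Eliminating a block with pivot p leaves 0 - D_i (1/p) C_i = -1/p as
  the next pivot, so the pivots alternate between 1 and -1.\<close>

primrec fwd :: "(nat \<Rightarrow> 'a) \<Rightarrow> nat \<Rightarrow> 'a" where
  "fwd f 0 = 0"
| "fwd f (Suc i) = (if i = 0 then f 1 else (- 1) ^ i *\<^sub>R (f (Suc i) - D i (fwd f i)))"

text \<open>Back substitution; the first argument counts the blocks still to the right, so the
  solution in block \<open>i\<close> is taken at \<open>n - i\<close>.\<close>

primrec bwd :: "(nat \<Rightarrow> 'a) \<Rightarrow> nat \<Rightarrow> nat \<Rightarrow> 'a" where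
  "bwd f 0 i = fwd f i"
| "bwd f (Suc k) i = fwd f i - (- 1) ^ (i - 1) *\<^sub>R C i (bwd f k (Suc i))"

text \<open>Block elimination: \<open>D i\<close> is a left inverse of \<open>C i\<close>, so all pivots are \<open>\<plusminus> 1\<close>.\<close>

lemma row_surj:
  assumes f: "\<forall>i\<in>{1..n}. f i \<in> X i"
  shows "\<exists>x. (\<forall>i\<in>{1..n}. x i \<in> X i) \<and> (\<forall>i\<in>{1..n}. row n x i = f i)"
proof -
  define x where "x i = bwd f (n - i) i" for i
  have g_in: "i \<in> {1..n} \<Longrightarrow> fwd f i \<in> X i" for i
    by (induction i) (use f in \<open>auto simp: in_X D_in\<close>)
  have bwd_in: "1 \<le> i \<Longrightarrow> i + k \<le> n \<Longrightarrow> bwd f k i \<in> X i" for i k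
    by (induction k arbitrary: i) (auto simp: in_X g_in C_in)
  have x_in: "x i \<in> X i" if "i \<in> {1..n}" for i
    using that bwd_in[of i "n - i"] by (simp add: x_def)
  have x_rec: "x i = fwd f i - (- 1) ^ (i - 1) *\<^sub>R upper_row n x i" if "i \<in> {1..n}" for i
  proof (cases "i < n")
    case True
    hence "n - i = Suc (n - Suc i)" by simp
    thus ?thesis using True by (simp add: x_def upper_row_def)
  next
    case False
    thus ?thesis using that by (simp add: x_def upper_row_def)
  qed
  have "row n x i = f i" if i: "i \<in> {1..n}" for i
  proof (cases "i = 1")
    case True
    thus ?thesis using x_rec[of 1] that by (simp add: row_def lower_row_def)
  next
    case False
    define q where "q = i - 1"
    have q: "i = Suc q" "1 \<le> q" "q < n" using that False by (auto simp: q_def)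
    have sgn: "(- 1) ^ (q - 1) = - ((- 1) ^ q :: real)" "(- 1) ^ q * (- 1) ^ q = (1 :: real)"
      using q by (cases q; simp add: power_mult_distrib[symmetric])+
    have "D q (x q) = D q (fwd f q - (- 1) ^ (q - 1) *\<^sub>R C q (x i))"
      using q x_rec[of q] by (simp add: upper_row_def)
    also have "\<dots> = D q (fwd f q) - (- 1) ^ (q - 1) *\<^sub>R x i"
      using q x_in[of i] g_in[of q] i by (simp add: D_diff D_scale D_C C_in in_X)
    also have "\<dots> = D q (fwd f q) + (- 1) ^ q *\<^sub>R x i"
      unfolding sgn(1) by simp
    also have "(- 1) ^ q *\<^sub>R x i = f i - D q (fwd f q) - upper_row n x i"
    proof -
      have "(- 1) ^ q *\<^sub>R x i = ((- 1) ^ q * (- 1) ^ q) *\<^sub>R (f i - D q (fwd f q))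
          - ((- 1) ^ q * (- 1) ^ q) *\<^sub>R upper_row n x i"
        using q by (subst x_rec[OF i]) (simp add: scaleR_diff_right)
      thus ?thesis by (simp only: sgn scaleR_one)
    qed
    finally show ?thesis using q by (simp add: row_def lower_row_def)
  qed
  thus ?thesis using x_in by blast
qed

end

section \<open>Normed spaces, operators and duals\<close>

definition norm_like :: "'a::real_vector nspace \<Rightarrow> bool"
  where "norm_like E \<longleftrightarrow> subspace (pts E) \<and> (\<forall>x\<in>pts E. 0 \<le> nrm E x \<and> (nrm E x = 0 \<longleftrightarrow> x = 0))"

lemma norm_like_hilbert: "subspace V \<Longrightarrow> norm_like (hilbert V)"
  by (simp add: norm_like_def hilbert_def)

lemma op_norm_bound:
  assumes E: "norm_like E" and K: "\<forall>x\<in>pts E. nrm F (T x) \<le> K * nrm E x" and x: "x \<in> pts E"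
  shows "nrm F (T x) \<le> op_norm E F T * nrm E x"
proof (cases "nrm E x = 0")
  case True
  thus ?thesis using K x by force
next
  case False
  \<comment> \<open>\<open>K\<close> may be negative, while the quotient at 0 is 0; hence the
    absolute value.\<close>
  have "nrm F (T y) / nrm E y \<le> \<bar>K\<bar>" if "y \<in> pts E" for y
  proof -
    have "nrm F (T y) \<le> \<bar>K\<bar> * nrm E y"
      using K E that by (meson abs_ge_self dual_order.trans mult_right_mono norm_like_def)
    thus ?thesis using E that
      by (cases "nrm E y = 0") (auto simp: norm_like_def divide_le_eq less_le)
  qed
  hence "nrm F (T x) / nrm E x \<le> op_norm E F T"
    unfolding op_norm_def using x by (intro cSUP_upper) (auto intro!: bdd_aboveI2)
  thus ?thesis using False E x by (auto simp: norm_like_def divide_le_eq less_le)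
qed

text \<open>The case \<open>c = 0\<close> is allowed to be attained at \<open>x\<^sub>0 = 0\<close>, where the quotient is \<open>0 / 0 = 0\<close>.\<close>

lemma op_norm_eqI:
  assumes E: "norm_like E" and c: "0 \<le> c" "\<And>x. x \<in> pts E \<Longrightarrow> nrm F (T x) \<le> c * nrm E x"
    and x0: "x\<^sub>0 \<in> pts E" "nrm F (T x\<^sub>0) = c * nrm E x\<^sub>0" "c \<noteq> 0 \<Longrightarrow> x\<^sub>0 \<noteq> 0"
  shows "op_norm E F T = c"
proof -
  have le: "nrm F (T x) / nrm E x \<le> c" if "x \<in> pts E" for x
    using c(1) c(2)[OF that] E that
    by (cases "nrm E x = 0") (auto simp: norm_like_def divide_le_eq less_le)
  have "nrm F (T x\<^sub>0) / nrm E x\<^sub>0 = c"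
    using x0 E by (cases "c = 0") (auto simp: norm_like_def)
  thus ?thesis
    unfolding op_norm_def using le x0(1) by (intro cSup_eq_maximum) (auto intro: image_eqI[of _ _ x\<^sub>0])
qed

lemma in_dual_iff:
  "f \<in> pts (dual E) \<longleftrightarrow>
    (\<forall>x\<in>pts E. \<forall>y\<in>pts E. f (x + y) = f x + f y) \<and>
    (\<forall>c. \<forall>x\<in>pts E. f (c *\<^sub>R x) = c * f x) \<and>
    (\<exists>K. \<forall>x\<in>pts E. \<bar>f x\<bar> \<le> K * nrm E x) \<and> (\<forall>x. x \<notin> pts E \<longrightarrow> f x = 0)"
  by (simp add: dual_def bounded_ops_def Let_def)

lemma nrm_dual: "nrm (dual E) f = op_norm E \<lparr>pts = UNIV, nrm = abs\<rparr> f"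
  by (simp add: dual_def Let_def)

lemma dual_bound:
  assumes "norm_like E" "f \<in> pts (dual E)" "x \<in> pts E"
  shows "\<bar>f x\<bar> \<le> nrm (dual E) f * nrm E x"
proof -
  obtain K where "\<forall>x\<in>pts E. \<bar>f x\<bar> \<le> K * nrm E x" using assms(2) by (auto simp: in_dual_iff)
  thus ?thesis
    using op_norm_bound[of E "\<lparr>pts = UNIV, nrm = abs\<rparr>" f K x] assms by (simp add: nrm_dual)
qed

lemma inv_op_eqI:
  assumes "inj_on T (pts E)" "x \<in> pts E" "T x \<in> pts F"
  shows "inv_op E F T (T x) = x"
  using assms by (simp add: inv_op_def)

lemma isomorphismI:
  assumes E: "norm_like E" and T: "T \<in> bounded_ops E F"
    and surj: "\<And>y. y \<in> pts F \<Longrightarrow> \<exists>x\<in>pts E. T x = y"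
    and c: "0 < c" "\<And>x. x \<in> pts E \<Longrightarrow> c * nrm E x \<le> nrm F (T x)"
  shows "isomorphism E F T"
proof -
  note V = subspace_0 subspace_add subspace_scale subspace_diff
  have sub: "subspace (pts E)" using E by (simp add: norm_like_def)
  have T_in: "T x \<in> pts F" and T_add: "T (x + y) = T x + T y" and T_scale: "T (a *\<^sub>R x) = a *\<^sub>R T x"
    if "x \<in> pts E" "y \<in> pts E" for x y a
    using T that by (auto simp: bounded_ops_def)
  have "\<exists>K. \<forall>x\<in>pts E. nrm F (T x) \<le> K * nrm E x"
    using T by (simp add: bounded_ops_def)
  then obtain K where K: "\<And>x. x \<in> pts E \<Longrightarrow> nrm F (T x) \<le> K * nrm E x" by blast
  have T0: "T 0 = 0" using T_scale[of 0 0 0] sub by (simp add: V)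
  have inj: "inj_on T (pts E)"
  proof (rule inj_onI)
    fix x y assume xy: "x \<in> pts E" "y \<in> pts E" "T x = T y"
    have d: "x - y \<in> pts E" using xy sub by (simp add: V)
    have "T (x - y) = T 0"
      using T_add[of "x - y" y] d xy by (simp add: T0)
    \<comment> \<open>Nothing is known about \<open>nrm F\<close> at 0, so it is controlled through
      the boundedness of \<open>T\<close>.\<close>
    hence "c * nrm E (x - y) \<le> K * nrm E 0"
      using c(2)[OF d] K[of 0] sub by (simp add: V)
    also have "\<dots> = 0" using E sub by (simp add: norm_like_def V)
    finally have "nrm E (x - y) = 0"
      using c(1) E d by (auto simp: norm_like_def mult_le_0_iff)
    thus "x = y" using E d by (auto simp: norm_like_def)
  qed
  have bij: "bij_betw T (pts E) (pts F)"
    using inj surj T_in by (fastforce simp: bij_betw_def)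
  have inv: "inv_op E F T (T x) = x" if "x \<in> pts E" for x
    using inj that T_in by (intro inv_op_eqI) auto
  have "inv_op E F T \<in> bounded_ops F E"
    unfolding bounded_ops_def
  proof (intro CollectI conjI ballI allI impI exI[of _ "1 / c"])
    fix y z :: 'b and a :: real assume "y \<in> pts F"
    then obtain x where x: "x \<in> pts E" "y = T x" using surj by blast
    show "inv_op E F T y \<in> pts E" using x inv by simp
    show "inv_op E F T (a *\<^sub>R y) = a *\<^sub>R inv_op E F T y"
      using x inv inv[of "a *\<^sub>R x"] sub by (simp add: V T_scale)
    show "nrm E (inv_op E F T y) \<le> 1 / c * nrm F y"
      using x inv c(2)[OF x(1)] c(1) by (simp add: field_simps)
    assume "z \<in> pts F"
    then obtain w where w: "w \<in> pts E" "z = T w" using surj by blast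
    show "inv_op E F T (y + z) = inv_op E F T y + inv_op E F T z"
      using x w inv inv[of "x + w"] sub by (simp add: V T_add)
  qed (simp add: inv_op_def)
  thus ?thesis using T bij by (simp add: isomorphism_def)
qed

lemma isomorphism_inv:
  assumes "isomorphism E F T" "x \<in> pts E"
  shows "inv_op E F T (T x) = x"
  using assms by (intro inv_op_eqI) (auto simp: isomorphism_def bij_betw_def)

lemma bounded_ops_dualI:
  assumes E: "norm_like E" and F: "norm_like F"
    and add_left: "\<And>x y z. x \<in> pts E \<Longrightarrow> y \<in> pts E \<Longrightarrow> z \<in> pts F \<Longrightarrow> B (x + y) z = B x z + B y z"
    and scale_left: "\<And>c x z. x \<in> pts E \<Longrightarrow> z \<in> pts F \<Longrightarrow> B (c *\<^sub>R x) z = c * B x z"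
    and add_right: "\<And>x y z. x \<in> pts E \<Longrightarrow> y \<in> pts F \<Longrightarrow> z \<in> pts F \<Longrightarrow> B x (y + z) = B x y + B x z"
    and scale_right: "\<And>c x z. x \<in> pts E \<Longrightarrow> z \<in> pts F \<Longrightarrow> B x (c *\<^sub>R z) = c * B x z"
    and K: "0 \<le> K" "\<And>x z. x \<in> pts E \<Longrightarrow> z \<in> pts F \<Longrightarrow> \<bar>B x z\<bar> \<le> K * nrm E x * nrm F z"
    and zero: "\<And>x z. x \<notin> pts E \<or> z \<notin> pts F \<Longrightarrow> B x z = 0"
  shows "B \<in> bounded_ops E (dual F)"
  unfolding bounded_ops_def
proof (intro CollectI conjI ballI allI impI exI[of _ K])
  fix x y :: 'a and c :: real assume x: "x \<in> pts E"
  show "B x \<in> pts (dual F)"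
    unfolding in_dual_iff using x add_right scale_right K(2) zero by blast
  show "B (c *\<^sub>R x) = c *\<^sub>R B x"
  proof (rule ext)
    fix z
    have "c *\<^sub>R x \<in> pts E" using x E by (simp add: norm_like_def subspace_scale)
    thus "B (c *\<^sub>R x) z = (c *\<^sub>R B x) z"
      using x scale_left zero by (cases "z \<in> pts F") (auto simp: scaleR_fun_def)
  qed
  have "nrm (dual F) (B x) \<le> K * nrm E x"
    unfolding nrm_dual op_norm_def
  proof (rule cSUP_least)
    show "pts F \<noteq> {}" using F subspace_0 by (auto simp: norm_like_def)
    fix z assume z: "z \<in> pts F"
    show "nrm \<lparr>pts = UNIV, nrm = abs\<rparr> (B x z) / nrm F z \<le> K * nrm E x"
      using K(1) K(2)[OF x z] E F x z
      by (cases "nrm F z = 0") (auto simp: norm_like_def divide_le_eq less_le)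
  qed
  thus "nrm (dual F) (B x) \<le> K * nrm E x" .
  assume y: "y \<in> pts E"
  show "B (x + y) = B x + B y"
  proof (rule ext)
    fix z
    show "B (x + y) z = (B x + B y) z"
      using x y add_left zero by (cases "z \<in> pts F") auto
  qed
next
  fix x assume "x \<notin> pts E"
  thus "B x = 0" using zero by (auto simp: fun_eq_iff)
qed

lemma bounded_ops_dualD:
  assumes E: "norm_like E" and F: "norm_like F" and B: "B \<in> bounded_ops E (dual F)"
  shows "x \<in> pts E \<Longrightarrow> y \<in> pts E \<Longrightarrow> B (x + y) z = B x z + B y z"
    and "x \<in> pts E \<Longrightarrow> B (c *\<^sub>R x) z = c * B x z"
    and "x \<in> pts E \<Longrightarrow> B x \<in> pts (dual F)"
    and "x \<notin> pts E \<or> z \<notin> pts F \<Longrightarrow> B x z = 0"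
    and "\<exists>K\<ge>0. \<forall>x\<in>pts E. \<forall>z\<in>pts F. \<bar>B x z\<bar> \<le> K * nrm E x * nrm F z"
proof -
  show "x \<in> pts E \<Longrightarrow> y \<in> pts E \<Longrightarrow> B (x + y) z = B x z + B y z"
    "x \<in> pts E \<Longrightarrow> B (c *\<^sub>R x) z = c * B x z"
    using B by (auto simp: bounded_ops_def scaleR_fun_def)
  show in_dual: "x \<in> pts E \<Longrightarrow> B x \<in> pts (dual F)" for x
    using B by (auto simp: bounded_ops_def)
  have "x \<notin> pts E \<Longrightarrow> B x = 0" using B by (auto simp: bounded_ops_def)
  thus "x \<notin> pts E \<or> z \<notin> pts F \<Longrightarrow> B x z = 0"
    using in_dual[of x] by (cases "x \<in> pts E") (auto simp: in_dual_iff)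
  have "\<exists>K. \<forall>x\<in>pts E. nrm (dual F) (B x) \<le> K * nrm E x"
    using B by (simp add: bounded_ops_def)
  then obtain K where K: "\<And>x. x \<in> pts E \<Longrightarrow> nrm (dual F) (B x) \<le> K * nrm E x" by blast
  have "\<bar>B x z\<bar> \<le> \<bar>K\<bar> * nrm E x * nrm F z" if "x \<in> pts E" "z \<in> pts F" for x z
  proof -
    have "K * nrm E x \<le> \<bar>K\<bar> * nrm E x"
      using E that by (intro mult_right_mono) (auto simp: norm_like_def)
    hence "nrm (dual F) (B x) * nrm F z \<le> \<bar>K\<bar> * nrm E x * nrm F z"
      using K[OF that(1)] F that by (intro mult_right_mono) (auto simp: norm_like_def)
    thus ?thesis using dual_bound[OF F in_dual[OF that(1)] that(2)] by linarith
  qed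
  thus "\<exists>K\<ge>0. \<forall>x\<in>pts E. \<forall>z\<in>pts F. \<bar>B x z\<bar> \<le> K * nrm E x * nrm F z"
    by (intro exI[of _ "\<bar>K\<bar>"]) auto
qed

text \<open>Composition with the isometry leaves the norm of the operator unchanged, and the
  supremum for the inverse is reindexed along \<open>S\<close>.\<close>

lemma cond_num_isometry_comp:
  assumes S: "isomorphism E F S" "\<And>x. x \<in> pts E \<Longrightarrow> nrm F (S x) = nrm E x"
    and T: "isomorphism E E T" and ST: "isomorphism E F (S \<circ> T)"
  shows "cond_num E F (S \<circ> T) = cond_num E E T"
proof -
  have T_in: "T x \<in> pts E" if "x \<in> pts E" for x
    using T that by (auto simp: isomorphism_def bij_betw_def)
  have F: "pts F = S ` pts E" using S(1) by (auto simp: isomorphism_def bij_betw_def)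
  have "op_norm E F (S \<circ> T) = op_norm E E T"
    unfolding op_norm_def using S(2) T_in by (intro SUP_cong) auto
  moreover have "inv_op E F (S \<circ> T) (S x) = inv_op E E T x" if "x \<in> pts E" for x
  proof -
    have "x \<in> T ` pts E" using T that by (simp add: isomorphism_def bij_betw_def)
    then obtain y where y: "y \<in> pts E" "x = T y" by blast
    show ?thesis using isomorphism_inv[OF ST y(1)] isomorphism_inv[OF T y(1)] y by simp
  qed
  hence "op_norm F E (inv_op E F (S \<circ> T)) = op_norm E E (inv_op E E T)"
    unfolding op_norm_def F image_image using S(2) by (intro SUP_cong) auto
  ultimately show ?thesis by (simp add: cond_num_def)
qed

section \<open>The Riesz representation theorem\<close>

lemma (in inner_form) parallelogram_law:
  assumes "x \<in> V" "y \<in> V"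
  shows "s (x + y) (x + y) + s (x - y) (x - y) = 2 * s x x + 2 * s y y"
  using assms by (simp add: add_left add_right diff_left diff_right in_V)

lemma (in inner_form) add_scale_square:
  assumes "x \<in> V" "y \<in> V"
  shows "s (x + t *\<^sub>R y) (x + t *\<^sub>R y) = s x x + 2 * t * s x y + t\<^sup>2 * s y y"
  using assms sym[of x y]
  by (simp add: add_left add_right scale_left scale_right in_V power2_eq_square algebra_simps)

text \<open>The representing vector is the minimizer of \<open>s x x - 2 f x\<close>; by the parallelogram law every
  minimizing sequence is Cauchy.\<close>

lemma riesz_representation:
  fixes V :: "'a::real_inner set"
  assumes s: "inner_form V s" and V: "complete V"
    and \<sigma>: "\<sigma> > 0" "\<And>x. x \<in> V \<Longrightarrow> \<sigma> * (norm x)\<^sup>2 \<le> s x x"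
    and K: "\<And>x y. x \<in> V \<Longrightarrow> y \<in> V \<Longrightarrow> \<bar>s x y\<bar> \<le> K * norm x * norm y"
    and f_add: "\<And>x y. x \<in> V \<Longrightarrow> y \<in> V \<Longrightarrow> f (x + y) = f x + f y"
    and f_scale: "\<And>c x. x \<in> V \<Longrightarrow> f (c *\<^sub>R x) = c * f x"
    and L: "\<And>x. x \<in> V \<Longrightarrow> \<bar>f x\<bar> \<le> L * norm x"
  shows "\<exists>y\<in>V. \<forall>x\<in>V. s y x = f x"
proof -
  interpret inner_form V s by (rule s)
  define J where "J x = s x x - 2 * f x" for x
  define d where "d = (INF x\<in>V. J x)"
  have "- (L\<^sup>2 / \<sigma>) \<le> J x" if "x \<in> V" for x
  proof -
    \<comment> \<open>Completing the square: coercivity beats the linear term, so \<open>J\<close>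
      is bounded below.\<close>
    have "0 \<le> (\<sigma> * norm x - L)\<^sup>2 / \<sigma>" using \<sigma>(1) by simp
    also have "\<dots> = \<sigma> * (norm x)\<^sup>2 - 2 * (L * norm x) + L\<^sup>2 / \<sigma>"
      using \<sigma>(1) by (simp add: field_simps power2_eq_square)
    also have "\<dots> \<le> J x + L\<^sup>2 / \<sigma>"
      using \<sigma>(2)[OF that] L[OF that] by (auto simp: J_def)
    finally show ?thesis by simp
  qed
  hence bdd: "bdd_below (J ` V)" by (intro bdd_belowI2)
  have d: "d \<le> J x" if "x \<in> V" for x
    unfolding d_def using bdd that by (rule cINF_lower)
  have "\<exists>x\<in>V. J x < d + 1 / real (Suc k)" for k
    using cINF_less_iff[OF _ bdd, of "d + 1 / real (Suc k)"] in_V(1) by (auto simp: d_def)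
  then obtain u where u: "\<And>k. u k \<in> V" "\<And>k. J (u k) < d + 1 / real (Suc k)" by metis
  have close: "\<sigma> * (norm (x - y))\<^sup>2 \<le> 2 * (J x - d) + 2 * (J y - d)" if "x \<in> V" "y \<in> V" for x y
  proof -
    \<comment> \<open>At the midpoint \<open>J\<close> is still at least the infimum, which leaves
      no room for two near-minimizers to be far apart.\<close>
    define c where "c = (1 / 2) *\<^sub>R (x + y)"
    have c: "c \<in> V" using that by (simp add: c_def in_V)
    have "s (x + y) (x + y) = 4 * s c c"
      using that by (simp add: c_def scale_left scale_right in_V)
    moreover have "2 * f c = f x + f y"
      using that by (simp add: c_def f_scale f_add in_V)
    ultimately have "s (x - y) (x - y) = 2 * J x + 2 * J y - 4 * J c"
      using parallelogram_law[OF that] by (simp add: J_def)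
    thus ?thesis using \<sigma>(2)[of "x - y"] d[OF c] that by (simp add: in_V)
  qed
  have "Cauchy u"
  proof (rule metric_CauchyI)
    fix e :: real assume e: "e > 0"
    obtain N where N: "1 / real (Suc N) < \<sigma> * e\<^sup>2 / 4"
      using nat_approx_posE[of "\<sigma> * e\<^sup>2 / 4"] \<sigma>(1) e by auto
    show "\<exists>M. \<forall>m\<ge>M. \<forall>n\<ge>M. dist (u m) (u n) < e"
    proof (intro exI allI impI)
      fix m n assume mn: "m \<ge> N" "n \<ge> N"
      define r where "r k = 1 / real (Suc k)" for k
      have "r m \<le> r N" "r n \<le> r N"
        using mn by (auto simp: r_def intro!: frac_le)
      moreover have "J (u m) < d + r m" "J (u n) < d + r n" "4 * r N < \<sigma> * e\<^sup>2"
        using u(2) N by (simp_all add: r_def)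
      ultimately have "2 * (J (u m) - d) + 2 * (J (u n) - d) < \<sigma> * e\<^sup>2"
        by argo
      hence "\<sigma> * (norm (u m - u n))\<^sup>2 < \<sigma> * e\<^sup>2"
        by (rule le_less_trans[OF close[OF u(1)[of m] u(1)[of n]]])
      hence "(norm (u m - u n))\<^sup>2 < e\<^sup>2" using \<sigma>(1) by simp
      thus "dist (u m) (u n) < e" using e by (auto simp: dist_norm intro: power2_less_imp_less)
    qed
  qed
  then obtain y where y: "y \<in> V" "u \<longlonglongrightarrow> y" using V u(1) by (auto simp: complete_def)
  have "s y x = f x" if x: "x \<in> V" for x
  proof -
    have "(\<lambda>k. norm (u k - y)) \<longlonglongrightarrow> 0"
      using y(2) by (simp add: LIM_zero_iff tendsto_norm_zero_iff)
    hence "(\<lambda>k. K * norm x * norm (u k - y)) \<longlonglongrightarrow> K * norm x * 0"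
      by (intro tendsto_mult tendsto_const)
    hence "(\<lambda>k. s (u k) x - s y x) \<longlonglongrightarrow> 0"
    proof (intro Lim_null_comparison[of "\<lambda>k. s (u k) x - s y x"])
      show "\<forall>\<^sub>F k in sequentially. norm (s (u k) x - s y x) \<le> K * norm x * norm (u k - y)"
        using K[of "u _ - y" x] u(1) y(1) x
        by (intro always_eventually) (simp add: diff_left in_V mult.assoc mult.commute[of "norm x"])
    qed simp
    hence lim: "(\<lambda>k. s (u k) x) \<longlonglongrightarrow> s y x" by (simp add: LIM_zero_iff)
    define a where "a = s y x - f x"
    \<comment> \<open>The minimizing sequence is perturbed in direction \<open>x\<close> before the
      limit is taken, so that only the convergence of \<open>s (u k) x\<close> enters.\<close>
    have ineq: "0 \<le> 2 * t * a + t\<^sup>2 * s x x" for t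
    proof -
      have "d \<le> d + 1 / real (Suc k) + (2 * t * (s (u k) x - f x) + t\<^sup>2 * s x x)" for k
      proof -
        have "d \<le> J (u k + t *\<^sub>R x)" using u(1) x by (intro d) (simp add: in_V)
        also have "\<dots> = J (u k) + (2 * t * (s (u k) x - f x) + t\<^sup>2 * s x x)"
          using u(1)[of k] x by (simp add: J_def add_scale_square f_add f_scale in_V algebra_simps)
        finally show ?thesis using u(2)[of k] by linarith
      qed
      moreover have "(\<lambda>k. d + 1 / real (Suc k) + (2 * t * (s (u k) x - f x) + t\<^sup>2 * s x x))
          \<longlonglongrightarrow> d + 0 + (2 * t * (s y x - f x) + t\<^sup>2 * s x x)"
        using lim LIMSEQ_inverse_real_of_nat
        by (intro tendsto_intros) (auto simp: inverse_eq_divide)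
      ultimately have "d \<le> d + 0 + (2 * t * (s y x - f x) + t\<^sup>2 * s x x)"
        by (intro LIMSEQ_le_const) auto
      thus ?thesis by (simp add: a_def)
    qed
    \<comment> \<open>Adding 1 keeps the denominator positive also for \<open>x = 0\<close>; the
      parameter \<open>- a / b\<close> makes the quadratic negative unless
      \<open>a = 0\<close>.\<close>
    define b where "b = s x x + 1"
    have b: "b \<ge> 1" using nonneg[OF x] by (simp add: b_def)
    have "0 \<le> 2 * (- a / b) * a + (- a / b)\<^sup>2 * (b - 1)"
      using ineq[of "- a / b"] by (simp add: b_def)
    also have "\<dots> = - (a\<^sup>2 * (b + 1) / b\<^sup>2)"
      using b by (simp add: field_simps power2_eq_square)
    finally have "a\<^sup>2 * (b + 1) / b\<^sup>2 \<le> 0" by simp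
    hence "a = 0" using b by (auto simp: divide_le_0_iff mult_le_0_iff)
    thus ?thesis by (simp add: a_def)
  qed
  thus ?thesis using y(1) by blast
qed

section \<open>Coercive forms and the passage to the next Schur complement\<close>

locale coercive_form =
  fixes V :: "'a::real_inner set" and s :: "'a \<Rightarrow> 'a \<Rightarrow> real"
  assumes subspace_V: "subspace V"
    and complete: "complete V"
    and symmetric: "x \<in> V \<Longrightarrow> y \<in> V \<Longrightarrow> s x y = s y x"
    and additive: "x \<in> V \<Longrightarrow> y \<in> V \<Longrightarrow> z \<in> V \<Longrightarrow> s (x + y) z = s x z + s y z"
    and homogeneous: "x \<in> V \<Longrightarrow> y \<in> V \<Longrightarrow> s (c *\<^sub>R x) y = c * s x y"
    and bounded: "\<exists>K\<ge>0. \<forall>x\<in>V. \<forall>y\<in>V. \<bar>s x y\<bar> \<le> K * norm x * norm y"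
    and coercive: "\<exists>\<sigma>>0. \<forall>x\<in>V. \<sigma> * (norm x)\<^sup>2 \<le> s x x"
    and zero_outside: "x \<notin> V \<or> y \<notin> V \<Longrightarrow> s x y = 0"

sublocale coercive_form \<subseteq> inner_form V s
proof
  show "0 < s x x" if "x \<in> V" "x \<noteq> 0" for x
  proof -
    obtain \<sigma> where "\<sigma> > 0" "\<sigma> * (norm x)\<^sup>2 \<le> s x x" using coercive \<open>x \<in> V\<close> by blast
    moreover have "0 < \<sigma> * (norm x)\<^sup>2" using calculation that by simp
    ultimately show ?thesis by linarith
  qed
qed (use subspace_V symmetric additive homogeneous in auto)

context coercive_form
begin

lemma riesz:
  assumes f: "f \<in> pts (dual (hilbert V))"
  shows "\<exists>y\<in>V. s y = f"
proof -
  obtain \<sigma> where \<sigma>: "\<sigma> > 0" "\<And>x. x \<in> V \<Longrightarrow> \<sigma> * (norm x)\<^sup>2 \<le> s x x" using coercive by blast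
  obtain K where K: "\<And>x y. x \<in> V \<Longrightarrow> y \<in> V \<Longrightarrow> \<bar>s x y\<bar> \<le> K * norm x * norm y" using bounded by blast
  obtain L where L: "\<And>x. x \<in> V \<Longrightarrow> \<bar>f x\<bar> \<le> L * norm x"
    using f unfolding in_dual_iff hilbert_def nspace.simps by blast
  have "f (x + y) = f x + f y" "f (c *\<^sub>R x) = c * f x" if "x \<in> V" "y \<in> V" for x y c
    using f that by (auto simp: in_dual_iff hilbert_def)
  then obtain y where y: "y \<in> V" "\<And>x. x \<in> V \<Longrightarrow> s y x = f x"
    using riesz_representation[OF inner_form_axioms complete \<sigma> K _ _ L] by blast
  have "s y = f"
  proof (rule ext)
    fix x show "s y x = f x"
      using y zero_outside f by (cases "x \<in> V") (auto simp: in_dual_iff hilbert_def)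
  qed
  thus ?thesis using y by blast
qed

abbreviation riesz_inv :: "('a \<Rightarrow> real) \<Rightarrow> 'a"
  where "riesz_inv \<equiv> inv_op (hilbert V) (dual (hilbert V)) s"

lemma riesz_inv:
  assumes "f \<in> pts (dual (hilbert V))"
  shows "riesz_inv f \<in> V" "s (riesz_inv f) = f"
proof -
  have "f \<in> s ` V" using riesz[OF assms] by blast
  thus "riesz_inv f \<in> V" "s (riesz_inv f) = f"
    using assms by (auto simp: inv_op_def hilbert_def inv_into_into f_inv_into_f)
qed

text \<open>\<open>B (c y) z\<close> is the next Schur complement once its diagonal block is 0.
  Rewritten as \<open>s (c y) (c z)\<close> it is visibly symmetric, and the same equation says that
  \<open>c\<close> is an isometry. Testing with \<open>c y\<close> itself and using coercivity
  bounds \<open>c\<close> by \<open>K / \<sigma>\<close>.\<close>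

lemma schur_step:
  assumes W: "subspace W" and B: "B \<in> bounded_ops (hilbert V) (dual (hilbert W))"
  defines "c \<equiv> \<lambda>y. riesz_inv (dual_adjoint B y)"
  shows "y \<in> W \<Longrightarrow> c y \<in> V"
    and "y \<in> W \<Longrightarrow> s (c y) x = B x y"
    and "y \<in> W \<Longrightarrow> z \<in> W \<Longrightarrow> B (c y) z = s (c y) (c z)"
    and "y \<notin> W \<or> z \<notin> W \<Longrightarrow> B (c y) z = 0"
    and "\<exists>K\<ge>0. \<forall>y\<in>W. \<forall>z\<in>W. \<bar>B (c y) z\<bar> \<le> K * norm y * norm z"
proof -
  note D = bounded_ops_dualD[OF norm_like_hilbert[OF subspace_V] norm_like_hilbert[OF W] B,
    unfolded hilbert_def nspace.simps, folded hilbert_def]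
  obtain K where K: "K \<ge> 0" "\<And>x z. x \<in> V \<Longrightarrow> z \<in> W \<Longrightarrow> \<bar>B x z\<bar> \<le> K * norm x * norm z"
    using D(5) by blast
  obtain \<sigma> where \<sigma>: "\<sigma> > 0" "\<And>x. x \<in> V \<Longrightarrow> \<sigma> * (norm x)\<^sup>2 \<le> s x x" using coercive by blast
  have adj: "dual_adjoint B y \<in> pts (dual (hilbert V))" for y
  proof -
    have "\<exists>K. \<forall>x\<in>V. \<bar>B x y\<bar> \<le> K * norm x"
    proof (intro exI ballI)
      fix x assume "x \<in> V"
      thus "\<bar>B x y\<bar> \<le> (K * norm y) * norm x"
        using K D(4)[of x y] by (cases "y \<in> W") (auto simp: mult_ac)
    qed
    thus ?thesis using D(1,2,4) by (simp add: in_dual_iff hilbert_def dual_adjoint_def)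
  qed
  have c: "c y \<in> V" "s (c y) = dual_adjoint B y" for y
    using riesz_inv[OF adj] by (auto simp: c_def)
  show "y \<in> W \<Longrightarrow> c y \<in> V" by (rule c)
  show "y \<in> W \<Longrightarrow> s (c y) x = B x y" by (simp add: c dual_adjoint_def)
  show "y \<in> W \<Longrightarrow> z \<in> W \<Longrightarrow> B (c y) z = s (c y) (c z)"
    by (subst symmetric[OF c(1) c(1)]) (simp add: c(2)[of z] dual_adjoint_def)
  show "y \<notin> W \<or> z \<notin> W \<Longrightarrow> B (c y) z = 0"
  proof (cases "z \<in> W")
    case True
    assume "y \<notin> W \<or> z \<notin> W"
    \<comment> \<open>Outside \<open>W\<close> the adjoint is the zero functional, so its
      representing vector is 0.\<close>
    hence "s (c y) (c y) = 0" using True D(4) by (simp add: c(2) dual_adjoint_def)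
    hence "c y = 0" using c(1) eq_0_iff by blast
    thus ?thesis using D(2)[of 0 0 z] in_V(1) by simp
  qed (use D(4) in simp)
  have norm_c: "norm (c y) \<le> K / \<sigma> * norm y" if "y \<in> W" for y
  proof (cases "c y = 0")
    case False
    have "\<sigma> * (norm (c y))\<^sup>2 \<le> \<bar>B (c y) y\<bar>"
    proof -
      have "s (c y) (c y) = B (c y) y" by (simp add: c(2)[of y] dual_adjoint_def)
      thus ?thesis using \<sigma>(2)[OF c(1)[of y]] by linarith
    qed
    also have "\<dots> \<le> K * norm (c y) * norm y" using K(2) c(1) that by blast
    finally show ?thesis using False \<sigma>(1) by (simp add: power2_eq_square field_simps)
  qed (use K(1) \<sigma>(1) in simp)
  have "\<bar>B (c y) z\<bar> \<le> (K * (K / \<sigma>)) * norm y * norm z" if "y \<in> W" "z \<in> W" for y z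
  proof -
    have "\<bar>B (c y) z\<bar> \<le> K * norm (c y) * norm z" using K(2) c(1) that by blast
    also have "\<dots> \<le> K * (K / \<sigma> * norm y) * norm z"
      using norm_c[OF that(1)] K(1) by (intro mult_right_mono mult_left_mono) auto
    finally show ?thesis by (simp add: mult_ac)
  qed
  thus "\<exists>K\<ge>0. \<forall>y\<in>W. \<forall>z\<in>W. \<bar>B (c y) z\<bar> \<le> K * norm y * norm z"
    using K(1) \<sigma>(1) by (intro exI[of _ "K * (K / \<sigma>)"]) auto
qed

end

section \<open>The preconditioned operator\<close>

locale coercive_chain = isometric_chain n X s C D
  for n :: nat and X :: "nat \<Rightarrow> 'a::real_inner set" and s :: "nat \<Rightarrow> 'a \<Rightarrow> 'a \<Rightarrow> real"
    and C D :: "nat \<Rightarrow> 'a \<Rightarrow> 'a" +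
  assumes coercive_form: "1 \<le> i \<Longrightarrow> i \<le> n \<Longrightarrow> coercive_form (X i) (s i)"
    and n: "1 \<le> n" and nontrivial: "X n \<noteq> {0}"
begin

definition SS :: "(nat \<Rightarrow> 'a) \<Rightarrow> (nat \<Rightarrow> 'a) \<Rightarrow> real"
  where "SS = diag_op n X s"

definition XX :: "(nat \<Rightarrow> 'a) nspace"
  where "XX = \<lparr>pts = prod_space n X, nrm = (\<lambda>x. sqrt (SS x x))\<rparr>"

text \<open>The preconditioned operator written out by rows; that it is the inverse of
  \<open>SS\<close> applied to the tridiagonal operator follows from \<open>tridiag_eq\<close> and
  \<open>inv_SS\<close>.\<close>

definition M :: "(nat \<Rightarrow> 'a) \<Rightarrow> nat \<Rightarrow> 'a"
  where "M x = (if x \<in> prod_space n X then \<lambda>i. if i \<in> {1..n} then row n x i else 0 else 0)"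

lemma XX_simps [simp]: "pts XX = prod_space n X" "nrm XX x = sqrt (SS x x)"
  by (simp_all add: XX_def)

lemma SS_eq:
  assumes "x \<in> prod_space n X" "y \<in> prod_space n X"
  shows "SS x y = (\<Sum>i=1..n. s i (x i) (y i))"
proof -
  have "(\<Sum>j=1..n. (if i = j then s i else 0) (x j) (y i)) = s i (x i) (y i)" if "i \<in> {1..n}" for i
  proof -
    have "(\<Sum>j=1..n. (if i = j then s i else 0) (x j) (y i)) = (\<Sum>j=1..n. if i = j then s i (x j) (y i) else 0)"
      by (intro sum.cong) auto
    thus ?thesis using that by simp
  qed
  thus ?thesis using assms by (auto simp: SS_def diag_op_def block_op_def intro!: sum.cong)
qed

lemma SS_outside: "x \<notin> prod_space n X \<or> y \<notin> prod_space n X \<Longrightarrow> SS x y = 0"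
  by (auto simp: SS_def diag_op_def block_op_def)

lemma prod_in: "x \<in> prod_space n X \<Longrightarrow> 1 \<le> i \<Longrightarrow> i \<le> n \<Longrightarrow> x i \<in> X i"
  by (simp add: prod_space_def)

lemma subspace_prod: "subspace (prod_space n X)"
  by (auto simp: subspace_def prod_space_def in_X scaleR_fun_def)

sublocale SS: inner_form "prod_space n X" SS
proof
  note P = subspace_0[OF subspace_prod] subspace_add[OF subspace_prod] subspace_scale[OF subspace_prod]
  show "subspace (prod_space n X)" by (rule subspace_prod)
  show "SS x y = SS y x" if "x \<in> prod_space n X" "y \<in> prod_space n X" for x y
    using that by (auto simp: SS_eq prod_in intro!: sum.cong inner_form.sym[OF form])
  show "SS (x + y) z = SS x z + SS y z"
    if "x \<in> prod_space n X" "y \<in> prod_space n X" "z \<in> prod_space n X" for x y z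
    using that P by (auto simp: SS_eq prod_in sum.distrib[symmetric] intro!: sum.cong inner_form.add_left[OF form])
  show "SS (c *\<^sub>R x) y = c * SS x y" if "x \<in> prod_space n X" "y \<in> prod_space n X" for c x y
    using that P by (auto simp: SS_eq prod_in sum_distrib_left scaleR_fun_def
        intro!: sum.cong inner_form.scale_left[OF form])
  show "0 < SS x x" if x: "x \<in> prod_space n X" "x \<noteq> 0" for x
  proof -
    obtain i where "x i \<noteq> 0" using x(2) by (auto simp: fun_eq_iff)
    moreover from this have "i \<in> {1..n}" using x(1) by (auto simp: prod_space_def)
    ultimately show ?thesis unfolding SS_eq[OF x(1) x(1)]
      using x(1) by (intro sum_pos2[of _ i])
        (auto simp: prod_in intro: inner_form.pos[OF form] inner_form.nonneg[OF form])
  qed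
qed

lemma norm_like_XX: "norm_like XX"
  using SS.subspace SS.nonneg SS.eq_0_iff by (auto simp: norm_like_def)

text \<open>The Riesz theorem is applied to each block, and the representing vectors are put
  together.\<close>

lemma SS_surj:
  assumes f: "f \<in> pts (dual XX)"
  shows "\<exists>y\<in>prod_space n X. SS y = f"
proof -
  have f_add: "f (x + y) = f x + f y" if "x \<in> prod_space n X" "y \<in> prod_space n X" for x y
    using f that by (auto simp: in_dual_iff)
  have f_scale: "f (c *\<^sub>R x) = c * f x" if "x \<in> prod_space n X" for x c
    using f that by (auto simp: in_dual_iff)
  have "\<exists>K. \<forall>x\<in>prod_space n X. \<bar>f x\<bar> \<le> K * sqrt (SS x x)"
    using f by (simp add: in_dual_iff)
  then obtain L where L: "\<And>x. x \<in> prod_space n X \<Longrightarrow> \<bar>f x\<bar> \<le> L * sqrt (SS x x)" by blast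
  define e :: "nat \<Rightarrow> 'a \<Rightarrow> nat \<Rightarrow> 'a" where "e i v = (\<lambda>k. if k = i then v else 0)" for i v
  have e_in: "e i v \<in> prod_space n X" if "i \<in> {1..n}" "v \<in> X i" for i v
    using that by (auto simp: e_def prod_space_def in_X)
  have "\<exists>y\<in>X i. s i y = (\<lambda>v. if v \<in> X i then f (e i v) else 0)" if i: "i \<in> {1..n}" for i
  proof -
    interpret F: coercive_form "X i" "s i" using i by (intro coercive_form) auto
    obtain K where K: "K \<ge> 0" "\<And>x y. x \<in> X i \<Longrightarrow> y \<in> X i \<Longrightarrow> \<bar>s i x y\<bar> \<le> K * norm x * norm y"
      using F.bounded by blast
    \<comment> \<open>The functional is bounded in the norm of \<open>SS\<close>, whereas the Riesz
      theorem on \<open>X i\<close> asks for the original norm; the bound of \<open>s i\<close>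
      mediates.\<close>
    have bound: "\<bar>f (e i v)\<bar> \<le> (\<bar>L\<bar> * sqrt K) * norm v" if v: "v \<in> X i" for v
    proof -
      have "SS (e i v) (e i v) = (\<Sum>k=1..n. if k = i then s i v v else 0)"
        unfolding SS_eq[OF e_in[OF i v] e_in[OF i v]]
        by (intro sum.cong) (auto simp: e_def inner_form.zero_left[OF form] in_X)
      hence "SS (e i v) (e i v) \<le> K * (norm v)\<^sup>2"
        using i K(2)[OF v v] by (simp add: power2_eq_square mult_ac)
      hence "sqrt (SS (e i v) (e i v)) \<le> sqrt K * norm v"
        by (metis real_sqrt_le_mono real_sqrt_mult real_sqrt_abs abs_norm_cancel)
      hence "\<bar>L\<bar> * sqrt (SS (e i v) (e i v)) \<le> \<bar>L\<bar> * (sqrt K * norm v)"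
        by (intro mult_left_mono) auto
      moreover have "L * sqrt (SS (e i v) (e i v)) \<le> \<bar>L\<bar> * sqrt (SS (e i v) (e i v))"
        using SS.nonneg[OF e_in[OF i v]] by (intro mult_right_mono) auto
      ultimately show ?thesis using L[OF e_in[OF i v]] by (simp add: mult.assoc)
    qed
    hence "\<exists>K. \<forall>v\<in>X i. \<bar>f (e i v)\<bar> \<le> K * norm v" by blast
    moreover have "e i (v + w) = e i v + e i w" "e i (c *\<^sub>R v) = c *\<^sub>R e i v" for v w c
      by (auto simp: e_def scaleR_fun_def fun_eq_iff)
    ultimately have "(\<lambda>v. if v \<in> X i then f (e i v) else 0) \<in> pts (dual (hilbert (X i)))"
      using F.in_V i e_in by (auto simp: in_dual_iff hilbert_def f_add f_scale)
    thus ?thesis by (rule F.riesz)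
  qed
  then obtain g where g: "\<And>i. i \<in> {1..n} \<Longrightarrow> g i \<in> X i"
    "\<And>i v. i \<in> {1..n} \<Longrightarrow> v \<in> X i \<Longrightarrow> s i (g i) v = f (e i v)"
    by (metis (mono_tags, lifting))
  define y where "y i = (if i \<in> {1..n} then g i else 0)" for i
  have y: "y \<in> prod_space n X" using g(1) by (auto simp: y_def prod_space_def)
  have "SS y x = f x" for x
  proof (cases "x \<in> prod_space n X")
    case x: True
    define t :: "nat \<Rightarrow> nat \<Rightarrow> 'a" where "t m = (\<lambda>k. if k \<le> m then x k else 0)" for m
    have t_in: "t m \<in> prod_space n X" for m
      using x by (auto simp: t_def prod_space_def in_X)
    have "m \<le> n \<Longrightarrow> f (t m) = (\<Sum>i=1..m. f (e i (x i)))" for m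
    proof (induction m)
      case 0
      have "t 0 = 0" using x by (auto simp: t_def prod_space_def fun_eq_iff)
      moreover have "f 0 = 0" using f_scale[of 0 0] SS.in_V(1) by simp
      ultimately have "f (t 0) = 0" by (simp only:)
      thus ?case by simp
    next
      case (Suc m)
      have "t (Suc m) = t m + e (Suc m) (x (Suc m))"
        by (auto simp: t_def e_def fun_eq_iff le_Suc_eq)
      moreover have "f (t m + e (Suc m) (x (Suc m))) = f (t m) + f (e (Suc m) (x (Suc m)))"
        using Suc x by (intro f_add t_in e_in prod_in) auto
      ultimately have "f (t (Suc m)) = f (t m) + f (e (Suc m) (x (Suc m)))" by (simp only:)
      thus ?case using Suc by simp
    qed
    moreover have "t n = x" using x by (auto simp: t_def prod_space_def fun_eq_iff)
    ultimately have "f x = (\<Sum>i=1..n. f (e i (x i)))" by (metis order_refl)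
    also have "\<dots> = SS y x"
      using x y by (auto simp: SS_eq y_def g prod_in intro!: sum.cong)
    finally show ?thesis by simp
  next
    case False
    thus ?thesis using f SS_outside by (simp add: in_dual_iff)
  qed
  thus ?thesis using y by blast
qed

lemma SS_in_bounded_ops: "SS \<in> bounded_ops XX (dual XX)"
proof (rule bounded_ops_dualI[OF norm_like_XX norm_like_XX, of _ 1])
  show "\<bar>SS x z\<bar> \<le> 1 * nrm XX x * nrm XX z" if "x \<in> pts XX" "z \<in> pts XX" for x z
    using SS.cauchy_schwarz that by simp
qed (auto simp: SS.add_left SS.add_right SS.scale_left SS.scale_right SS_outside)

text \<open>Cauchy-Schwarz, with equality at \<open>x\<close> itself: \<open>SS\<close> is an
  isometry onto the dual, hence the equality of the two condition numbers.\<close>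

lemma nrm_dual_SS:
  assumes "x \<in> prod_space n X"
  shows "nrm (dual XX) (SS x) = nrm XX x"
  unfolding nrm_dual
proof (rule op_norm_eqI[OF norm_like_XX, where x\<^sub>0=x])
  show "nrm \<lparr>pts = UNIV, nrm = abs\<rparr> (SS x x) = nrm XX x * nrm XX x"
    using assms SS.nonneg by simp
qed (use assms SS.cauchy_schwarz SS.nonneg in auto)

lemma isomorphism_SS: "isomorphism XX (dual XX) SS"
proof (rule isomorphismI[OF norm_like_XX SS_in_bounded_ops, of 1])
  show "\<exists>x\<in>pts XX. SS x = y" if "y \<in> pts (dual XX)" for y
    using SS_surj[OF that] by simp
qed (simp_all add: nrm_dual_SS[simplified])

lemma inv_SS: "x \<in> prod_space n X \<Longrightarrow> inv_op XX (dual XX) SS (SS x) = x"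
  using isomorphism_inv[OF isomorphism_SS] by simp

lemma M_eq: "x \<in> prod_space n X \<Longrightarrow> i \<in> {1..n} \<Longrightarrow> M x i = row n x i"
  by (simp add: M_def)

lemma M_in:
  assumes "x \<in> prod_space n X"
  shows "M x \<in> prod_space n X"
  using assms row_in[of n x] by (auto simp: M_def prod_space_def)

lemma M_outside: "x \<notin> prod_space n X \<Longrightarrow> M x = 0"
  by (simp add: M_def)

lemma SS_M_eq:
  assumes "x \<in> prod_space n X"
  shows "SS (M x) (M x) = (\<Sum>i=1..n. s i (row n x i) (row n x i))"
  by (simp add: SS_eq M_in assms M_eq)

lemma M_upper:
  assumes "x \<in> prod_space n X"
  shows "nrm XX (M x) \<le> (2 * cos (eig_angle n 1)) * nrm XX x"
proof -
  have c: "0 \<le> cos (eig_angle n 1)"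
    using eig_angle_bounds[of 1 n] n by (intro cos_ge_zero) (auto simp: eig_angle_def field_simps)
  have "SS (M x) (M x) \<le> (2 * cos (eig_angle n 1))\<^sup>2 * SS x x"
    unfolding SS_M_eq[OF assms] SS_eq[OF assms assms]
  proof (rule row_upper)
    show "three_term n (2 * cos (eig_angle n 1)) (\<lambda>k. cos ((real k - 1 / 2) * eig_angle n 1))"
      using n by (intro cos_three_term cos_eig_angle) auto
  qed (use max_eigvec_pos assms in \<open>auto simp: prod_in\<close>)
  hence "sqrt (SS (M x) (M x)) \<le> sqrt ((2 * cos (eig_angle n 1))\<^sup>2 * SS x x)"
    by (rule real_sqrt_le_mono)
  thus ?thesis using c by (simp add: real_sqrt_mult)
qed

lemma sin_half_gap_pos: "0 < sin (half_gap m)"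
proof (rule sin_gt_zero)
  have "half_gap m \<le> pi / 2" by (simp add: half_gap_def field_simps)
  thus "half_gap m < pi" using pi_gt_zero by linarith
qed (rule half_gap_pos)

lemma M_lower:
  assumes "x \<in> prod_space n X"
  shows "(2 * sin (half_gap n)) * nrm XX x \<le> nrm XX (M x)"
proof -
  have "(2 * sin (half_gap n))\<^sup>2 * SS x x \<le> SS (M x) (M x)"
    unfolding SS_M_eq[OF assms] SS_eq[OF assms assms]
    using assms by (intro row_lower) (auto simp: prod_in)
  hence "sqrt ((2 * sin (half_gap n))\<^sup>2 * SS x x) \<le> sqrt (SS (M x) (M x))"
    by (rule real_sqrt_le_mono)
  thus ?thesis using sin_half_gap_pos[of n] by (simp add: real_sqrt_mult)
qed

lemma M_surj:
  assumes "y \<in> prod_space n X"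
  shows "\<exists>x\<in>prod_space n X. M x = y"
proof -
  obtain x where x: "\<forall>i\<in>{1..n}. x i \<in> X i" "\<forall>i\<in>{1..n}. row n x i = y i"
    using row_surj[of y] assms by (auto simp: prod_in)
  define x' where "x' i = (if i \<in> {1..n} then x i else 0)" for i
  have x': "x' \<in> prod_space n X" using x by (auto simp: x'_def prod_space_def)
  have "row n x' i = row n x i" if "i \<in> {1..n}" for i
    using that n by (auto simp: row_def lower_row_def upper_row_def x'_def)
  hence "M x' = y"
    using x' x(2) assms by (auto simp: M_def prod_space_def fun_eq_iff)
  thus ?thesis using x' by blast
qed

lemma M_add:
  assumes "x \<in> prod_space n X" "y \<in> prod_space n X"
  shows "M (x + y) = M x + M y"
proof
  fix i
  show "M (x + y) i = (M x + M y) i"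
  proof (cases "i \<in> {1..n}")
    case True
    have "x (i - 1) \<in> X (i - 1)" "y (i - 1) \<in> X (i - 1)" if "i \<noteq> 1"
      using True that assms prod_in[of _ "i - 1"] by auto
    moreover have "D (i - 1) (a + b) = D (i - 1) a + D (i - 1) b"
      if "i \<noteq> 1" "a \<in> X (i - 1)" "b \<in> X (i - 1)" for a b
      using that True by (intro D_add) auto
    moreover have "x (Suc i) \<in> X (Suc i)" "y (Suc i) \<in> X (Suc i)" if "i < n"
      using that True assms by (auto intro: prod_in)
    ultimately show ?thesis
      using True assms by (auto simp: M_def SS.in_V row_def lower_row_def upper_row_def C_add)
  qed (use assms in \<open>auto simp: M_def SS.in_V\<close>)
qed

lemma M_scale:
  assumes "x \<in> prod_space n X"
  shows "M (c *\<^sub>R x) = c *\<^sub>R M x"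
proof
  fix i
  show "M (c *\<^sub>R x) i = (c *\<^sub>R M x) i"
  proof (cases "i \<in> {1..n}")
    case True
    have "D (i - 1) (c *\<^sub>R x (i - 1)) = c *\<^sub>R D (i - 1) (x (i - 1))" if "i \<noteq> 1"
      using that True assms by (intro D_scale prod_in) auto
    moreover have "x (Suc i) \<in> X (Suc i)" if "i < n"
      using that True assms by (auto intro: prod_in)
    ultimately show ?thesis
      using True assms SS.in_V(4)[of x c]
      by (auto simp: M_def row_def lower_row_def upper_row_def C_scale scaleR_fun_def scaleR_add_right)
  qed (use assms SS.in_V(4)[of x c] in \<open>auto simp: M_def scaleR_fun_def\<close>)
qed

lemma isomorphism_M: "isomorphism XX XX M"
proof (rule isomorphismI[OF norm_like_XX])
  show "M \<in> bounded_ops XX XX"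
    unfolding bounded_ops_def using M_upper by (auto simp: M_in M_add M_scale M_outside)
  show "\<exists>x\<in>pts XX. M x = y" if "y \<in> pts XX" for y
    using M_surj that by simp
  show "0 < 2 * sin (half_gap n)" using sin_half_gap_pos by simp
qed (use M_lower in simp)

lemma isomorphism_SS_M: "isomorphism XX (dual XX) (SS \<circ> M)"
proof (rule isomorphismI[OF norm_like_XX])
  show "SS \<circ> M \<in> bounded_ops XX (dual XX)"
  proof (rule bounded_ops_dualI[OF norm_like_XX norm_like_XX, of _ "2 * cos (eig_angle n 1)"])
    show "0 \<le> 2 * cos (eig_angle n 1)"
      using eig_angle_bounds[of 1 n] n by (auto intro!: cos_ge_zero simp: eig_angle_def field_simps)
    show "\<bar>(SS \<circ> M) x z\<bar> \<le> (2 * cos (eig_angle n 1)) * nrm XX x * nrm XX z"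
      if "x \<in> pts XX" "z \<in> pts XX" for x z
    proof -
      have "\<bar>SS (M x) z\<bar> \<le> nrm XX (M x) * nrm XX z"
        using SS.cauchy_schwarz[OF M_in, of x z] that by simp
      also have "\<dots> \<le> (2 * cos (eig_angle n 1)) * nrm XX x * nrm XX z"
        using M_upper[of x] that SS.nonneg[of z] by (intro mult_right_mono) auto
      finally show ?thesis by simp
    qed
    show "(SS \<circ> M) x z = 0" if "x \<notin> pts XX \<or> z \<notin> pts XX" for x z
      using that SS_outside[of "M x" z] SS.zero_left[of z]
      by (cases "z \<in> prod_space n X") (auto simp: M_outside)
  qed (auto simp: M_add M_scale M_in SS.add_left SS.add_right SS.scale_left SS.scale_right)
  show "\<exists>x\<in>pts XX. (SS \<circ> M) x = y" if "y \<in> pts (dual XX)" for y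
    using SS_surj[OF that] M_surj by fastforce
  show "0 < 2 * sin (half_gap n)" using sin_half_gap_pos by simp
  show "2 * sin (half_gap n) * nrm XX x \<le> nrm (dual XX) ((SS \<circ> M) x)" if "x \<in> pts XX" for x
    using that M_lower by (simp add: nrm_dual_SS[simplified] M_in)
qed

lemma nrm_eigenvector:
  assumes "x \<in> prod_space n X" "M x = l *\<^sub>R x"
  shows "nrm XX (M x) = \<bar>l\<bar> * nrm XX x"
  using assms by (simp add: SS.scale_left SS.scale_right SS.in_V real_sqrt_mult mult.assoc[symmetric])

lemma abs_eigenvalue_bounds:
  assumes "l \<in> eigenvalues XX M"
  shows "\<bar>l\<bar> \<le> 2 * cos (eig_angle n 1)" "2 * sin (half_gap n) \<le> \<bar>l\<bar>"
proof -
  obtain x where x: "x \<in> prod_space n X" "x \<noteq> 0" "M x = l *\<^sub>R x"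
    using assms by (auto simp: eigenvalues_def)
  have "nrm XX x > 0" using SS.pos[OF x(1,2)] by simp
  thus "\<bar>l\<bar> \<le> 2 * cos (eig_angle n 1)" "2 * sin (half_gap n) \<le> \<bar>l\<bar>"
    using M_upper[OF x(1)] M_lower[OF x(1)] unfolding nrm_eigenvector[OF x(1,3)]
    by (simp_all only: mult_le_cancel_right_pos)
qed

lemma eigenvalues_subset: "eigenvalues XX M \<subseteq> {2 * cos (eig_angle j i) | i j. j \<in> {1..n} \<and> i \<in> {1..j}}"
proof
  fix l assume l: "l \<in> eigenvalues XX M"
  obtain x where x: "x \<in> prod_space n X" "x \<noteq> 0" "M x = l *\<^sub>R x"
    using l by (auto simp: eigenvalues_def)
  obtain k where "x k \<noteq> 0" using x(2) by (auto simp: fun_eq_iff)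
  hence "\<exists>i\<in>{1..n}. x i \<noteq> 0" using x(1) unfolding prod_space_def by blast
  moreover have "row n x i = l *\<^sub>R x i" if "i \<in> {1..n}" for i
    using M_eq[OF x(1) that] x(3) by (simp add: scaleR_fun_def)
  \<comment> \<open>Together with the norm bound this puts every eigenvalue strictly between -2 and
    2.\<close>
  moreover have "cos (eig_angle n 1) < cos 0"
    using eig_angle_bounds[of 1 n] n by (intro cos_monotone_0_pi) auto
  ultimately have "\<exists>j\<in>{1..n}. \<exists>i\<in>{1..j}. l = 2 * cos (eig_angle j i)"
    using abs_eigenvalue_bounds(1)[OF l] x(1) by (intro row_eigenvalue[of n x]) (auto simp: prod_in)
  thus "l \<in> {2 * cos (eig_angle j i) | i j. j \<in> {1..n} \<and> i \<in> {1..j}}" by blast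
qed

lemma eigenvector:
  assumes j: "j \<in> {1..n}" and i: "i \<in> {1..j}"
    and v: "v \<in> X j" "v \<noteq> 0" "j < n \<Longrightarrow> D j v = 0"
  shows "\<exists>x\<in>prod_space n X. x \<noteq> 0 \<and> M x = (2 * cos (eig_angle j i)) *\<^sub>R x"
proof -
  define x where "x k = (if k \<in> {1..j} then cos ((real k - 1 / 2) * eig_angle j i) *\<^sub>R dn (j - k) k v else 0)" for k
  note ev = row_eigenvector[OF j i v, folded x_def]
  have "x \<in> prod_space n X" using ev(1) j by (auto simp: prod_space_def x_def)
  moreover from this have "M x = (2 * cos (eig_angle j i)) *\<^sub>R x"
    using ev(3) by (auto simp: M_def prod_space_def fun_eq_iff scaleR_fun_def)
  ultimately show ?thesis using ev(2) by (metis zero_fun_apply)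
qed

text \<open>No operator follows the last block, so any nonzero vector of \<open>X n\<close> carries
  a copy of size \<open>n\<close>. Both extreme eigenvalues are of this size.\<close>

lemma top_eigenvector:
  assumes "i \<in> {1..n}"
  shows "\<exists>x\<in>prod_space n X. x \<noteq> 0 \<and> M x = (2 * cos (eig_angle n i)) *\<^sub>R x"
proof -
  obtain v where "v \<in> X n" "v \<noteq> 0" using nontrivial in_X(1)[of n] n by auto
  thus ?thesis using eigenvector[of n i v] n assms by auto
qed

lemma eigenvalues_eq:
  assumes "\<forall>i\<in>{1..n-1}. \<exists>x\<in>X i. x \<noteq> 0 \<and> D i x = 0"
  shows "eigenvalues XX M = {2 * cos (eig_angle j i) | i j. j \<in> {1..n} \<and> i \<in> {1..j}}"
proof (intro equalityI eigenvalues_subset subsetI)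
  fix l assume "l \<in> {2 * cos (eig_angle j i) | i j. j \<in> {1..n} \<and> i \<in> {1..j}}"
  then obtain i j where ij: "j \<in> {1..n}" "i \<in> {1..j}" "l = 2 * cos (eig_angle j i)" by blast
  have "\<exists>x\<in>prod_space n X. x \<noteq> 0 \<and> M x = l *\<^sub>R x"
  proof (cases "j = n")
    case True
    thus ?thesis using top_eigenvector ij by simp
  next
    case False
    then obtain v where "v \<in> X j" "v \<noteq> 0" "D j v = 0" using assms ij by force
    thus ?thesis using eigenvector[of j i v] ij by blast
  qed
  thus "l \<in> eigenvalues XX M" by (auto simp: eigenvalues_def)
qed

lemma finite_eigenvalues: "finite (eigenvalues XX M)"
proof (rule finite_subset[OF eigenvalues_subset])
  have "{2 * cos (eig_angle j i) | i j. j \<in> {1..n} \<and> i \<in> {1..j}}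
      \<subseteq> (\<lambda>(j, i). 2 * cos (eig_angle j i)) ` (SIGMA j:{1..n}. {1..j})"
    by auto
  thus "finite {2 * cos (eig_angle j i) | i j. j \<in> {1..n} \<and> i \<in> {1..j}}"
    by (rule finite_subset) simp
qed

lemma eigenvalue_max: "2 * cos (eig_angle n 1) \<in> eigenvalues XX M" "cos (eig_angle n 1) > 0"
proof -
  show "2 * cos (eig_angle n 1) \<in> eigenvalues XX M"
    using top_eigenvector[of 1] n by (auto simp: eigenvalues_def)
  show "cos (eig_angle n 1) > 0"
    using eig_angle_bounds[of 1 n] n by (intro cos_gt_zero) (auto simp: eig_angle_def field_simps)
qed

lemma eigenvalue_min:
  "\<exists>l\<in>eigenvalues XX M. \<bar>l\<bar> = 2 * sin (half_gap n)"
proof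
  show "2 * cos (eig_angle n (mid n)) \<in> eigenvalues XX M"
    using top_eigenvector[OF mid_in[OF n]] by (auto simp: eigenvalues_def)
  show "\<bar>2 * cos (eig_angle n (mid n))\<bar> = 2 * sin (half_gap n)"
    by (simp add: abs_mult abs_cos_eig_angle_mid)
qed

lemma op_norm_M: "op_norm XX XX M = 2 * cos (eig_angle n 1)"
proof -
  obtain x where x: "x \<in> prod_space n X" "x \<noteq> 0" "M x = (2 * cos (eig_angle n 1)) *\<^sub>R x"
    using eigenvalue_max(1) by (auto simp: eigenvalues_def)
  show ?thesis
    by (rule op_norm_eqI[OF norm_like_XX, where x\<^sub>0=x])
      (use x nrm_eigenvector[OF x(1,3)] M_upper eigenvalue_max(2) in auto)
qed

text \<open>The supremum is attained at the image of an eigenvector whose eigenvalue has the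
  smallest modulus.\<close>

lemma op_norm_inv_M: "op_norm XX XX (inv_op XX XX M) = 1 / (2 * sin (half_gap n))"
proof -
  obtain x l where x: "x \<in> prod_space n X" "x \<noteq> 0" "M x = l *\<^sub>R x" and l: "\<bar>l\<bar> = 2 * sin (half_gap n)"
    using eigenvalue_min by (auto simp: eigenvalues_def)
  have inv: "inv_op XX XX M (M y) = y" if "y \<in> prod_space n X" for y
    using isomorphism_inv[OF isomorphism_M] that by simp
  show ?thesis
  proof (rule op_norm_eqI[OF norm_like_XX, where x\<^sub>0="M x"])
    show "nrm XX (inv_op XX XX M y) \<le> 1 / (2 * sin (half_gap n)) * nrm XX y" if y: "y \<in> pts XX" for y
    proof -
      obtain z where "z \<in> prod_space n X" "M z = y" using M_surj y by auto
      thus ?thesis using inv[of z] M_lower[of z] sin_half_gap_pos[of n] by (simp add: field_simps)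
    qed
    show "nrm XX (inv_op XX XX M (M x)) = 1 / (2 * sin (half_gap n)) * nrm XX (M x)"
      unfolding nrm_eigenvector[OF x(1,3)] inv[OF x(1)] l using sin_half_gap_pos[of n] by simp
    show "M x \<noteq> 0" using x l sin_half_gap_pos[of n] by auto
  qed (use x M_in sin_half_gap_pos[of n] in \<open>auto simp: SS.in_V\<close>)
qed

lemma Max_abs_eigenvalues: "Max {\<bar>l\<bar> | l. l \<in> eigenvalues XX M} = 2 * cos (eig_angle n 1)"
proof (rule Max_eqI)
  show "finite {\<bar>l\<bar> | l. l \<in> eigenvalues XX M}"
    using finite_eigenvalues by (simp add: setcompr_eq_image)
  show "2 * cos (eig_angle n 1) \<in> {\<bar>l\<bar> | l. l \<in> eigenvalues XX M}"
    using eigenvalue_max by force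
qed (use abs_eigenvalue_bounds in auto)

lemma Max_inverse_abs_eigenvalues:
  "Max {1 / \<bar>l\<bar> | l. l \<in> eigenvalues XX M} = 1 / (2 * sin (half_gap n))"
proof (rule Max_eqI)
  show "finite {1 / \<bar>l\<bar> | l. l \<in> eigenvalues XX M}"
    using finite_eigenvalues by (simp add: setcompr_eq_image)
  show "1 / (2 * sin (half_gap n)) \<in> {1 / \<bar>l\<bar> | l. l \<in> eigenvalues XX M}"
    using eigenvalue_min by force
  show "y \<le> 1 / (2 * sin (half_gap n))" if "y \<in> {1 / \<bar>l\<bar> | l. l \<in> eigenvalues XX M}" for y
    using that abs_eigenvalue_bounds(2) sin_half_gap_pos[of n] by (auto intro!: frac_le)
qed

lemma cond_num_SS_M: "cond_num XX (dual XX) (SS \<circ> M) = cond_num XX XX M"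
  by (rule cond_num_isometry_comp[OF isomorphism_SS _ isomorphism_M isomorphism_SS_M])
    (simp add: nrm_dual_SS[simplified])

text \<open>The diagonal factor is taken out of each row: B_i = S_(i+1) D_i by assumption, and B_i'
  = S_i C_i by adjointness. The alternating sign is 1 in the first row and meets only zero blocks
  afterwards.\<close>

lemma tridiag_eq:
  assumes A: "A 1 = s 1" "\<And>i. i \<in> {2..n} \<Longrightarrow> A i = 0"
    and B: "\<And>i x y. 1 \<le> i \<Longrightarrow> i < n \<Longrightarrow> x \<in> X i \<Longrightarrow> y \<in> X (Suc i) \<Longrightarrow> B i x y = s (Suc i) (D i x) y"
  shows "tridiag_op n X A B = SS \<circ> M"
proof (intro ext)
  fix x y
  show "tridiag_op n X A B x y = (SS \<circ> M) x y"
  proof (cases "x \<in> prod_space n X \<and> y \<in> prod_space n X")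
    case True
    hence x: "x \<in> prod_space n X" and y: "y \<in> prod_space n X" by auto
    let ?T = "\<lambda>i j. if i = j then (- 1) ^ (i - 1) *\<^sub>R A i else if i = j + 1 then B j
      else if j = i + 1 then dual_adjoint (B i) else 0"
    have "(\<Sum>j=1..n. ?T i j (x j) (y i)) = s i (row n x i) (y i)" if i: "i \<in> {1..n}" for i
    proof -
      interpret F: inner_form "X i" "s i" using i by (intro form) auto
      have "(\<Sum>j=1..n. ?T i j (x j) (y i)) = (\<Sum>j=1..n. (if j = i then if i = 1 then s 1 (x 1) (y 1) else 0 else 0)
          + (if j = i - 1 then B j (x j) (y i) else 0) + (if j = Suc i then B i (y i) (x j) else 0))"
        using A by (intro sum.cong) (auto simp: dual_adjoint_def scaleR_fun_def)
      also have "\<dots> = (if i = 1 then s 1 (x 1) (y 1) else B (i - 1) (x (i - 1)) (y i))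
          + (if i < n then B i (y i) (x (Suc i)) else 0)"
        using i by (auto simp: sum.distrib Suc_le_eq)
      also have "(if i = 1 then s 1 (x 1) (y 1) else B (i - 1) (x (i - 1)) (y i)) = s i (lower_row x i) (y i)"
        using i B[of "i - 1" "x (i - 1)" "y i"] x y by (auto simp: lower_row_def prod_in Suc_le_eq)
      also have "(if i < n then B i (y i) (x (Suc i)) else 0) = s i (upper_row n x i) (y i)"
      proof (cases "i < n")
        case True
        hence "B i (y i) (x (Suc i)) = s i (y i) (C i (x (Suc i)))"
          using i x y B by (simp add: adjoint' prod_in)
        thus ?thesis using True i x y F.sym[of "y i"] by (simp add: upper_row_def prod_in C_in)
      qed (use i y in \<open>auto simp: upper_row_def prod_in inner_form.zero_left[OF form]\<close>)
      finally show ?thesis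
        using i x y lower_row_in[of n x i] upper_row_in[of n x i]
        by (simp add: row_def F.add_left prod_in)
    qed
    thus ?thesis
      using x y by (auto simp: tridiag_op_def block_op_def SS_eq M_in M_eq intro!: sum.cong)
  next
    case False
    thus ?thesis
      using SS_outside[of "M x" y] SS.zero_left[of y] M_outside[of x]
      by (cases "y \<in> prod_space n X") (auto simp: tridiag_op_def block_op_def)
  qed
qed

end

text \<open>Inverses and suprema are total functions here; the isomorphism claims in front ensure
  that they are the genuine inverses and operator norms.\<close>

theorem theorem2p3:
  fixes n :: nat
    and X :: "nat \<Rightarrow> 'a::real_inner set"
    and A B S :: "nat \<Rightarrow> 'a \<Rightarrow> 'a \<Rightarrow> real"
    and AA SS :: "(nat \<Rightarrow> 'a) \<Rightarrow> (nat \<Rightarrow> 'a) \<Rightarrow> real"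
    and XX :: "(nat \<Rightarrow> 'a) nspace"
    and M :: "(nat \<Rightarrow> 'a) \<Rightarrow> (nat \<Rightarrow> 'a)"
  assumes "n \<ge> 2"
    and "\<forall>i\<in>{1..n}. subspace (X i) \<and> complete (X i)"
    and "\<forall>i\<in>{1..n}. A i \<in> bounded_ops (hilbert (X i)) (dual (hilbert (X i)))"
    and "\<forall>i\<in>{1..n}. \<forall>x\<in>X i. \<forall>y\<in>X i. A i y x = A i x y"
    and "\<forall>i\<in>{1..n}. \<forall>x\<in>X i. A i x x \<ge> 0"
    and "\<forall>i\<in>{1..n-1}. B i \<in> bounded_ops (hilbert (X i)) (dual (hilbert (X (i + 1))))"
    and "S = schur X A B"
    and "\<forall>i\<in>{1..n}. \<exists>\<sigma>>0. \<forall>x\<in>X i. S i x x \<ge> \<sigma> * (norm x)\<^sup>2"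
    and "\<forall>i\<in>{2..n}. A i = 0"
    and "AA = tridiag_op n X A B"
    and "SS = diag_op n X S"
    and "XX = \<lparr>pts = prod_space n X, nrm = (\<lambda>x. sqrt (SS x x))\<rparr>"
    and "M = inv_op XX (dual XX) SS \<circ> AA"
    and "X n \<noteq> {0}"
  shows "isomorphism XX (dual XX) SS \<and> isomorphism XX (dual XX) AA \<and> isomorphism XX XX M \<and>
    eigenvalues XX M \<subseteq>
      {2 * cos ((2 * real i - 1) / (2 * real j + 1) * pi) | i j. j \<in> {1..n} \<and> i \<in> {1..j}} \<and>
    ((\<forall>i\<in>{1..n-1}. \<exists>x\<in>X i. x \<noteq> 0 \<and> B i x = 0) \<longrightarrow>
      eigenvalues XX M =
        {2 * cos ((2 * real i - 1) / (2 * real j + 1) * pi) | i j. j \<in> {1..n} \<and> i \<in> {1..j}}) \<and>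
    op_norm XX XX M = Max {\<bar>l\<bar> | l. l \<in> eigenvalues XX M} \<and>
    op_norm XX XX M = 2 * cos (pi / (2 * real n + 1)) \<and>
    op_norm XX XX (inv_op XX XX M) = Max {1 / \<bar>l\<bar> | l. l \<in> eigenvalues XX M} \<and>
    op_norm XX XX (inv_op XX XX M) = 1 / (2 * sin (pi / (2 * (2 * real n + 1)))) \<and>
    cond_num XX (dual XX) AA = cond_num XX XX M \<and>
    cond_num XX XX M = cos (pi / (2 * real n + 1)) / sin (pi / (2 * (2 * real n + 1)))"
proof -
  note n = assms(1) and S = assms(7)
  define C where "C i y = inv_op (hilbert (X i)) (dual (hilbert (X i))) (S i) (dual_adjoint (B i) y)" for i y
  define D where "D i x = inv_op (hilbert (X (Suc i))) (dual (hilbert (X (Suc i)))) (S (Suc i)) (B i x)" for i x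
  have sub: "subspace (X i)" "Topological_Spaces.complete (X i)" if "1 \<le> i" "i \<le> n" for i
    using assms(2) that by auto
  have B: "B i \<in> bounded_ops (hilbert (X i)) (dual (hilbert (X (Suc i))))" if "1 \<le> i" "i < n" for i
    using assms(6) that by auto
  have S_Suc: "S (Suc i) y z = B i (C i y) z" if "1 \<le> i" "i < n" for i y z
  proof -
    obtain k where "i = Suc k" using \<open>1 \<le> i\<close> by (cases i) auto
    moreover have "A (Suc i) = 0" using assms(9) that by auto
    ultimately show ?thesis by (simp add: S C_def)
  qed
  \<comment> \<open>The inverse in S_(i+1) is meaningful only once S_i is known to be bounded,
    symmetric and coercive, which forces an induction along the chain. Coercivity is a hypothesis in
    each step; the other properties are inherited.\<close>
  have cf: "1 \<le> i \<Longrightarrow> i \<le> n \<Longrightarrow> coercive_form (X i) (S i)" for i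
  proof (induction i)
    case (Suc i)
    have coercive: "\<exists>\<sigma>>0. \<forall>x\<in>X (Suc i). \<sigma> * (norm x)\<^sup>2 \<le> S (Suc i) x x"
      using assms(8) Suc.prems by auto
    show ?case
    proof (cases "i = 0")
      case True
      have A: "A 1 \<in> bounded_ops (hilbert (X 1)) (dual (hilbert (X 1)))" using assms(3) n by auto
      have V: "norm_like (hilbert (X 1))" using sub n by (intro norm_like_hilbert) auto
      have "coercive_form (X 1) (A 1)"
        using sub[of 1] n bounded_ops_dualD[OF V V A] assms(4) coercive True
        by unfold_locales (auto simp: hilbert_def S)
      thus ?thesis using True by (simp add: S)
    next
      case False
      hence i: "1 \<le> i" "i < n" using Suc.prems by auto
      interpret F: coercive_form "X i" "S i" using Suc i by auto
      note step = F.schur_step[OF sub(1)[of "Suc i"] B[OF i], folded C_def]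
      have W: "subspace (X (Suc i))" "Topological_Spaces.complete (X (Suc i))" using sub i by auto
      have V: "norm_like (hilbert (X i))" "norm_like (hilbert (X (Suc i)))"
        using norm_like_hilbert F.subspace W by auto
      note BD = bounded_ops_dualD[OF V B[OF i]]
      have sym: "S (Suc i) x y = S (Suc i) y x" if "x \<in> X (Suc i)" "y \<in> X (Suc i)" for x y
        using that step(1,3) i F.sym[of "C i x" "C i y"] by (simp add: S_Suc)
      have add: "S (Suc i) z (x + y) = S (Suc i) z x + S (Suc i) z y"
        and scale: "S (Suc i) z (c *\<^sub>R x) = c * S (Suc i) z x"
        if "x \<in> X (Suc i)" "y \<in> X (Suc i)" "z \<in> X (Suc i)" for x y z c
        using that step(1) i BD(3)[of "C i z"] by (auto simp: S_Suc in_dual_iff hilbert_def)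
      show ?thesis
      proof
        fix x y z :: 'a and c :: real
        assume x: "x \<in> X (Suc i)" and y: "y \<in> X (Suc i)"
        show "S (Suc i) (c *\<^sub>R x) y = c * S (Suc i) x y"
          using x y W scale[of x y y c] sym[of y] by (simp add: subspace_scale)
        assume "z \<in> X (Suc i)"
        thus "S (Suc i) (x + y) z = S (Suc i) x z + S (Suc i) y z"
          using x y W add[of x y z] sym[of z] by (simp add: subspace_add)
      qed (use W sym coercive step(4,5) i in \<open>auto simp: S_Suc\<close>)
    qed
  qed simp
  interpret cc: coercive_chain n X S C D
  proof (intro coercive_chain.intro isometric_chain.intro coercive_chain_axioms.intro)
    fix i assume i: "1 \<le> i" "i \<le> n"
    interpret F: coercive_form "X i" "S i" by (rule cf[OF i])
    show "inner_form (X i) (S i)" by (rule F.inner_form_axioms)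
    show "coercive_form (X i) (S i)" by (rule cf[OF i])
  next
    fix i assume i: "1 \<le> i" "i < n"
    interpret F: coercive_form "X i" "S i" using cf i by auto
    interpret G: coercive_form "X (Suc i)" "S (Suc i)" using cf i by auto
    note step = F.schur_step[OF G.subspace B[OF i], folded C_def]
    have V: "norm_like (hilbert (X i))" "norm_like (hilbert (X (Suc i)))"
      using norm_like_hilbert F.subspace G.subspace by auto
    note BD = bounded_ops_dualD[OF V B[OF i]]
    show "C i y \<in> X i" if "y \<in> X (Suc i)" for y
      by (rule step(1)[OF that])
    have D: "D i x \<in> X (Suc i)" "S (Suc i) (D i x) = B i x" if "x \<in> X i" for x
      using G.riesz_inv[OF BD(3)] that by (auto simp: D_def hilbert_def)
    show "D i x \<in> X (Suc i)" if "x \<in> X i" for x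
      by (rule D(1)[OF that])
    show "S i (C i y) x = S (Suc i) y (D i x)" if "x \<in> X i" "y \<in> X (Suc i)" for x y
      using that D step(2) by (simp add: G.sym[of y])
    show "S i (C i y) (C i z) = S (Suc i) y z" if "y \<in> X (Suc i)" "z \<in> X (Suc i)" for y z
      using that step(3) i by (simp add: S_Suc)
  qed (use n assms(14) in auto)
  have D: "S (Suc i) (D i x) y = B i x y" if "1 \<le> i" "i < n" "x \<in> X i" for i x y
  proof -
    interpret G: coercive_form "X (Suc i)" "S (Suc i)" using cf that by auto
    have "norm_like (hilbert (X i))" "norm_like (hilbert (X (Suc i)))"
      using that by (auto intro!: norm_like_hilbert sub)
    from bounded_ops_dualD(3)[OF this B] that have "B i x \<in> pts (dual (hilbert (X (Suc i))))"
      by (simp add: hilbert_def)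
    thus ?thesis by (simp add: D_def G.riesz_inv)
  qed
  have SS: "SS = cc.SS" by (simp add: cc.SS_def assms(11))
  have XX: "XX = cc.XX" by (simp add: cc.XX_def assms(12) SS)
  have AA: "AA = cc.SS \<circ> cc.M"
    unfolding assms(10) using assms(9) D by (intro cc.tridiag_eq) (auto simp: S)
  have M: "M = cc.M"
  proof
    fix x
    \<comment> \<open>Outside the carrier the value is 0, which also belongs to it, so the inverse
      of \<open>SS\<close> cancels for every \<open>x\<close>.\<close>
    have "cc.M x \<in> prod_space n X"
      using cc.M_in[of x] cc.M_outside[of x] cc.SS.in_V(1) by (cases "x \<in> prod_space n X") auto
    thus "M x = cc.M x" by (simp add: assms(13) SS XX AA cc.inv_SS)
  qed
  \<comment> \<open>The kernel condition is stated for \<open>B i\<close> and needed for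
    \<open>D i\<close>; definiteness of the Schur complement translates one into the other.\<close>
  have ev: "eigenvalues cc.XX cc.M = {2 * cos (eig_angle j i) | i j. j \<in> {1..n} \<and> i \<in> {1..j}}"
    if ker: "\<forall>i\<in>{1..n-1}. \<exists>x\<in>X i. x \<noteq> 0 \<and> B i x = 0"
  proof (intro cc.eigenvalues_eq ballI)
    fix i assume i: "i \<in> {1..n-1}"
    then obtain x where x: "x \<in> X i" "x \<noteq> 0" "B i x = 0" using ker by blast
    have i': "1 \<le> i" "i < n" using i by auto
    have "S (Suc i) (D i x) (D i x) = 0" using D[OF i' x(1)] x(3) by simp
    hence "D i x = 0"
      using inner_form.eq_0_iff[OF cc.form[of "Suc i"]] cc.D_in[OF i' x(1)] i' by simp
    thus "\<exists>x\<in>X i. x \<noteq> 0 \<and> D i x = 0" using x by blast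
  qed
  have angle: "eig_angle n 1 = pi / (2 * real n + 1)" by (simp add: eig_angle_def)
  show ?thesis
    unfolding SS XX AA M eig_angle_def[symmetric] angle[symmetric] half_gap_def[symmetric]
    using cc.isomorphism_SS cc.isomorphism_SS_M cc.isomorphism_M cc.eigenvalues_subset ev
      cc.op_norm_M cc.op_norm_inv_M cc.Max_abs_eigenvalues cc.Max_inverse_abs_eigenvalues
      cc.cond_num_SS_M
    by (simp add: cond_num_def[of cc.XX cc.XX])
qed

end
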